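(* Let $\mathcal{O}$ be the class of all outerplanar graphs. Then (a) $\chi_{\mathrm{pCFo}}(\mathcal{O}) = 5$; (b) $\chi_{\mathrm{pCFc}}(\mathcal{O}) = 3$; (c) $\chi_{\mathrm{pUMo}}(\mathcal{O}) = 5$; (d) $\chi_{\mathrm{pUMc}}(\mathcal{O}) = 5$.
   Context: Graphs are finite and simple. $N(v)$ denotes the open neighborhood of a vertex $v$ and $N[v]=N(v)\cup\{v\}$ its closed neighborhood. Colorings assign to vertices colors from $\{1,\dots,k\}$; a coloring is proper if adjacent vertices receive distinct colors. A pCFo-coloring (resp. pCFc-coloring) of a graph $G$ is a proper coloring of the vertices such that for every vertex $v$ there is at least one color appearing on exactly one vertex of $N(v)$ (resp. $N[v]$). A pUMo-coloring (resp. pUMc-coloring) of $G$ is a proper coloring of the vertices such that for every vertex $v$ the maximum color appearing on $N(v)$ (resp. $N[v]$) appears on exactly one vertex of $N(v)$ (resp. $N[v]$). $\chi_{\mathrm{pCFo}}(G)$, $\chi_{\mathrm{pCFc}}(G)$, $\chi_{\mathrm{pUMo}}(G)$, $\chi_{\mathrm{pUMc}}(G)$ denote the minimum $k$ such that $G$ has a coloring of the corresponding type with $k$ colors. For an invariant $\chi_{.}$ and a graph class $\mathcal{C}$, $\chi_{.}(\mathcal{C}) = \max\{\chi_{.}(G) \mid G \in \mathcal{C}\}$. For the open neighborhood variants (pCFo, pUMo), only graphs without isolated vertices are considered (i.e., the maximum is over graphs in the class having no isolated vertices). *)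

theory Defs
  imports "HOL-Analysis.Analysis" "HOL-Library.Infinite_Typeclass"
begin

section \<open>Finite simple graphs\<close>

record 'a graph =
  verts :: "'a set"
  edges :: "'a set set"

definition simple_graph :: "'a graph \<Rightarrow> bool" where
  "simple_graph G \<longleftrightarrow> finite (verts G) \<and> (\<forall>e\<in>edges G. e \<subseteq> verts G \<and> card e = 2)"

definition open_nbh :: "'a graph \<Rightarrow> 'a \<Rightarrow> 'a set" where
  "open_nbh G v = {u. {u, v} \<in> edges G}"

definition closed_nbh :: "'a graph \<Rightarrow> 'a \<Rightarrow> 'a set" where
  "closed_nbh G v = insert v (open_nbh G v)"

definition no_isolated :: "'a graph \<Rightarrow> bool" where
  "no_isolated G \<longleftrightarrow> (\<forall>v\<in>verts G. open_nbh G v \<noteq> {})"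

section \<open>Outerplanar graphs\<close>

text \<open>
  A drawing of \<open>G\<close> in the plane (the type \<open>complex\<close>): \<open>p\<close> places the vertices and
  \<open>\<gamma> e\<close> is the arc representing the edge \<open>e\<close>.
  The third condition says that an edge contains no vertex other than its ends, the fourth that
  two different edges meet at most in common ends.
\<close>

definition plane_drawing ::
    "'a graph \<Rightarrow> ('a \<Rightarrow> complex) \<Rightarrow> ('a set \<Rightarrow> real \<Rightarrow> complex) \<Rightarrow> bool" where
  "plane_drawing G p \<gamma> \<longleftrightarrow>
     inj_on p (verts G) \<and>
     (\<forall>e\<in>edges G. arc (\<gamma> e) \<and> {pathstart (\<gamma> e), pathfinish (\<gamma> e)} = p ` e) \<and>
     (\<forall>e\<in>edges G. path_image (\<gamma> e) \<inter> p ` verts G \<subseteq> p ` e) \<and>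
     (\<forall>e\<in>edges G. \<forall>f\<in>edges G. e \<noteq> f \<longrightarrow>
        path_image (\<gamma> e) \<inter> path_image (\<gamma> f) \<subseteq> p ` (e \<inter> f))"

definition drawn_set ::
    "'a graph \<Rightarrow> ('a \<Rightarrow> complex) \<Rightarrow> ('a set \<Rightarrow> real \<Rightarrow> complex) \<Rightarrow> complex set" where
  "drawn_set G p \<gamma> = p ` verts G \<union> (\<Union>e\<in>edges G. path_image (\<gamma> e))"

text \<open>
  The drawn set is compact, so its complement has exactly one unbounded component; hence
  \<open>outside (drawn_set G p \<gamma>)\<close> is the outer face. A graph is outerplanar if it can be drawn such
  that every vertex lies on the boundary of the outer face.
\<close>

definition outerplanar :: "'a graph \<Rightarrow> bool" where
  "outerplanar G \<longleftrightarrow> simple_graph G \<and>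
     (\<exists>p \<gamma>. plane_drawing G p \<gamma> \<and> p ` verts G \<subseteq> frontier (outside (drawn_set G p \<gamma>)))"

section \<open>Proper conflict-free and unique-maximum colorings\<close>

definition proper_coloring :: "'a graph \<Rightarrow> nat \<Rightarrow> ('a \<Rightarrow> nat) \<Rightarrow> bool" where
  "proper_coloring G k c \<longleftrightarrow>
     c ` verts G \<subseteq> {1..k} \<and> (\<forall>u v. {u, v} \<in> edges G \<longrightarrow> c u \<noteq> c v)"

definition appears_once :: "('a \<Rightarrow> nat) \<Rightarrow> 'a set \<Rightarrow> nat \<Rightarrow> bool" where
  "appears_once c S i \<longleftrightarrow> (\<exists>!u. u \<in> S \<and> c u = i)"

definition pCFo_coloring :: "'a graph \<Rightarrow> nat \<Rightarrow> ('a \<Rightarrow> nat) \<Rightarrow> bool" where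
  "pCFo_coloring G k c \<longleftrightarrow>
     proper_coloring G k c \<and> (\<forall>v\<in>verts G. \<exists>i. appears_once c (open_nbh G v) i)"

definition pCFc_coloring :: "'a graph \<Rightarrow> nat \<Rightarrow> ('a \<Rightarrow> nat) \<Rightarrow> bool" where
  "pCFc_coloring G k c \<longleftrightarrow>
     proper_coloring G k c \<and> (\<forall>v\<in>verts G. \<exists>i. appears_once c (closed_nbh G v) i)"

definition pUMo_coloring :: "'a graph \<Rightarrow> nat \<Rightarrow> ('a \<Rightarrow> nat) \<Rightarrow> bool" where
  "pUMo_coloring G k c \<longleftrightarrow> proper_coloring G k c \<and>
     (\<forall>v\<in>verts G. appears_once c (open_nbh G v) (Max (c ` open_nbh G v)))"

definition pUMc_coloring :: "'a graph \<Rightarrow> nat \<Rightarrow> ('a \<Rightarrow> nat) \<Rightarrow> bool" where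
  "pUMc_coloring G k c \<longleftrightarrow> proper_coloring G k c \<and>
     (\<forall>v\<in>verts G. appears_once c (closed_nbh G v) (Max (c ` closed_nbh G v)))"

text \<open>
  For the two open variants the minimum below ranges over an empty set if \<open>G\<close> has an isolated
  vertex; such graphs are excluded wherever these numbers are used.
\<close>

definition chi_pCFo :: "'a graph \<Rightarrow> nat" where
  "chi_pCFo G = (LEAST k. \<exists>c. pCFo_coloring G k c)"

definition chi_pCFc :: "'a graph \<Rightarrow> nat" where
  "chi_pCFc G = (LEAST k. \<exists>c. pCFc_coloring G k c)"

definition chi_pUMo :: "'a graph \<Rightarrow> nat" where
  "chi_pUMo G = (LEAST k. \<exists>c. pUMo_coloring G k c)"

definition chi_pUMc :: "'a graph \<Rightarrow> nat" where
  "chi_pUMc G = (LEAST k. \<exists>c. pUMc_coloring G k c)"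

text \<open>
  The relation \<open>max {f G | G \<in> C} = m\<close>, including the existence of the maximum. It is a relation
  because \<open>Max\<close> is unspecified on infinite sets.
\<close>

definition is_class_max :: "('a graph \<Rightarrow> nat) \<Rightarrow> 'a graph set \<Rightarrow> nat \<Rightarrow> bool" where
  "is_class_max f C m \<longleftrightarrow> (\<exists>G\<in>C. f G = m) \<and> (\<forall>G\<in>C. f G \<le> m)"

text \<open>
  Over an infinite vertex type every finite graph occurs up to isomorphism, so the following set
  represents the class of all outerplanar graphs.
\<close>

definition outerplanar_graphs :: "'a::infinite graph set" where
  "outerplanar_graphs = {G. outerplanar G}"

definition outerplanar_graphs_no_isolated :: "'a::infinite graph set" where
  "outerplanar_graphs_no_isolated = {G. outerplanar G \<and> no_isolated G}"

end

theory Submission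
  imports Defs "HOL-Complex_Analysis.Winding_Numbers"
begin

text \<open>
  Upper bounds. An outerplanar graph has a vertex of degree at most 2. Deleting it and joining its
  neighbours if there are two of them again gives an outerplanar graph, as the new edge can be drawn
  along the two deleted ones. Undoing these eliminations one by one, the returning vertex must avoid
  the colours of its at most two neighbours and the maxima currently seen by them, so five colours
  suffice for the unique-maximum variants, and three for properness. In a proper colouring the
  colour of \<open>v\<close> occurs only once in the closed neighbourhood of \<open>v\<close>, so pCFc-colourings are just
  proper colourings.

  For the vertex of small degree, suppose that all degrees are at least 3. Among all longest paths
  \<open>v\<^sub>0, v\<^sub>1, ...\<close> choose one with an edge from \<open>v\<^sub>0\<close> to \<open>v\<^sub>i\<close> for the smallest possible \<open>i \<ge> 2\<close>.
  Reversing the part before \<open>v\<^sub>i\<close> gives a longest path that starts at \<open>v\<^bsub>i-1\<^esub>\<close>, and both \<open>v\<^sub>0\<close> and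
  \<open>v\<^bsub>i-1\<^esub>\<close> have a neighbour beyond \<open>v\<^sub>i\<close>. This is a subdivision of the complete graph on four
  vertices, whose branch vertices cannot all lie on the outer face.

  Lower bounds. The triangle, the pentagon, and a triangle with two fans at each of its corners,
  drawn with vertices on a parabola.
\<close>

section \<open>Curves in the plane\<close>

text \<open>
  If no arc enters the inside \<open>I\<close> of the loop formed by the first two, then the winding number of
  that loop around \<open>I\<close> is the difference of those of the other two loops. So \<open>I\<close> lies inside one of
  them, and its boundary with it.
\<close>

lemma theta_curve_cases:
  fixes c1 c2 c3 :: "real \<Rightarrow> complex"
  assumes c1: "arc c1" "pathstart c1 = a" "pathfinish c1 = b"
    and c2: "arc c2" "pathstart c2 = a" "pathfinish c2 = b"
    and c3: "arc c3" "pathstart c3 = a" "pathfinish c3 = b"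
    and c12: "path_image c1 \<inter> path_image c2 = {a, b}"
    and c13: "path_image c1 \<inter> path_image c3 = {a, b}"
    and c23: "path_image c2 \<inter> path_image c3 = {a, b}"
  shows "path_image c1 - {a, b} \<subseteq> inside (path_image c2 \<union> path_image c3)
       \<or> path_image c2 - {a, b} \<subseteq> inside (path_image c1 \<union> path_image c3)
       \<or> path_image c3 - {a, b} \<subseteq> inside (path_image c1 \<union> path_image c2)"
proof (cases "path_image c3 \<inter> inside (path_image c1 \<union> path_image c2) = {}")
  case False
  have "a \<noteq> b"
    using c1 arc_distinct_ends by blast
  have "path_image c3 - {a, b} \<subseteq> inside (path_image c1 \<union> path_image c2)"
    using split_inside_simple_closed_curve
      [OF arc_imp_simple_path[OF c1(1)] c1(2,3) arc_imp_simple_path[OF c2(1)] c2(2,3)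
        arc_imp_simple_path[OF c3(1)] c3(2,3) \<open>a \<noteq> b\<close> c12 c13 c23 False]
    by blast
  then show ?thesis by blast
next
  case disj: True
  define loop where "loop g h = g +++ reversepath h" for g h :: "real \<Rightarrow> complex"
  have loop: "simple_path (loop g h)" "pathfinish (loop g h) = pathstart (loop g h)"
      "path_image (loop g h) = path_image g \<union> path_image h"
    if "arc g" "pathstart g = a" "pathfinish g = b" "arc h" "pathstart h = a" "pathfinish h = b"
      "path_image g \<inter> path_image h = {a, b}" for g h
    using that by (auto simp: loop_def path_image_join arc_reversepath intro!: simple_path_join_loop)
  have wn_loop: "winding_number (loop g h) z = winding_number g z - winding_number h z"
    if "arc g" "pathstart g = a" "pathfinish g = b" "arc h" "pathstart h = a" "pathfinish h = b"
      "z \<notin> path_image g" "z \<notin> path_image h" for g h z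
    using that by (simp add: loop_def winding_number_join winding_number_reversepath arc_imp_path)
  define I where "I = inside (path_image c1 \<union> path_image c2)"
  have I: "I \<noteq> {}" "connected I" "frontier I = path_image c1 \<union> path_image c2"
    using Jordan_inside_outside[OF loop(1,2)[OF c1 c2 c12]] by (auto simp: I_def loop(3)[OF c1 c2 c12])
  have I_disj: "I \<inter> (path_image c1 \<union> path_image c2 \<union> path_image c3) = {}"
    using disj inside_no_overlap[of "path_image c1 \<union> path_image c2"] unfolding I_def by blast
  obtain z where z: "z \<in> I" using I by blast
  have zn: "z \<notin> path_image c1" "z \<notin> path_image c2" "z \<notin> path_image c3"
    using z I_disj by auto
  have "norm (winding_number (loop c1 c2) z) = 1"
    using simple_closed_path_norm_winding_number_inside[OF loop(1)[OF c1 c2 c12]] z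
    by (simp add: I_def loop(3)[OF c1 c2 c12])
  then have "winding_number c1 z \<noteq> winding_number c2 z"
    using wn_loop[OF c1 c2 zn(1,2)] by auto
  then have ne: "winding_number (loop c1 c3) z \<noteq> 0 \<or> winding_number (loop c2 c3) z \<noteq> 0"
    using wn_loop[OF c1 c3 zn(1,3)] wn_loop[OF c2 c3 zn(2,3)] by auto
  \<comment> \<open>Here \<open>g\<close> is the one of \<open>c1\<close>, \<open>c2\<close> whose
    loop with \<open>c3\<close> winds around \<open>z\<close>, and \<open>c\<close> is the image of
    the other. As \<open>I\<close> is connected and misses that loop, it lies inside it;
    \<open>c\<close> belongs to the boundary of \<open>I\<close>, so it lies inside as well, except
    for common ends.\<close>
  have swallow: "c - {a, b} \<subseteq> inside (path_image g \<union> path_image c3)"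
    if g: "arc g" "pathstart g = a" "pathfinish g = b" "path_image g \<inter> path_image c3 = {a, b}"
      and gI: "path_image g \<subseteq> path_image c1 \<union> path_image c2"
      and nz: "winding_number (loop g c3) z \<noteq> 0"
      and c: "c \<subseteq> path_image c1 \<union> path_image c2" "c \<inter> (path_image g \<union> path_image c3) \<subseteq> {a, b}"
    for g c
  proof -
    let ?J = "path_image g \<union> path_image c3"
    note l = loop[OF g(1-3) c3 g(4)]
    have "z \<notin> ?J" using z I_disj gI by auto
    then have "z \<in> inside ?J"
      using nz winding_number_zero_in_outside[OF simple_path_imp_path[OF l(1)] l(2)]
      by (metis ComplI UnE inside_Un_outside l(3))
    have J: "open (inside ?J)" "open (outside ?J)" "inside ?J \<inter> outside ?J = {}"
        "inside ?J \<union> outside ?J = - ?J" "frontier (inside ?J) = ?J"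
      using Jordan_inside_outside[OF l(1,2)] by (auto simp: l(3))
    have "I \<subseteq> inside ?J \<union> outside ?J" using J(4) I_disj gI by auto
    then have "I \<subseteq> inside ?J"
      using connectedD[OF I(2) J(1,2)] J(3) \<open>z \<in> inside ?J\<close> z by blast
    then have "closure I \<subseteq> closure (inside ?J)" by (rule closure_mono)
    moreover have "closure (inside ?J) \<subseteq> inside ?J \<union> ?J"
      using J(1,5) by (auto simp: frontier_def interior_open)
    moreover have "c \<subseteq> closure I"
      using c(1) I(3) by (auto simp: frontier_def)
    ultimately show ?thesis using c(2) by blast
  qed
  from ne show ?thesis
  proof
    assume "winding_number (loop c1 c3) z \<noteq> 0"
    from swallow[OF c1 c13 _ this, of "path_image c2"] c12 c23 show ?thesis by blast
  next
    assume "winding_number (loop c2 c3) z \<noteq> 0"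
    from swallow[OF c2 c23 _ this, of "path_image c1"] c12 c13 show ?thesis by blast
  qed
qed

text \<open>The image of an arc is connected with more than one point, so all its points are limit
  points, and removing two points does not change that. The lemma is used for the ends of the
  arc.\<close>

lemma arc_end_in_closure_interior:
  fixes g :: "real \<Rightarrow> 'a::{t2_space,perfect_space,real_normed_vector}"
  assumes "arc g" "x \<in> path_image g"
  shows "x \<in> closure (path_image g - {pathstart g, pathfinish g})"
proof -
  have "\<nexists>z. path_image g = {z}"
    using arc_distinct_ends[OF assms(1)] pathstart_in_path_image[of g] pathfinish_in_path_image[of g]
    by force
  then have "x islimpt path_image g"
    using assms connected_imp_perfect connected_path_image arc_imp_path by blast
  moreover have "path_image g \<subseteq> {pathstart g, pathfinish g} \<union> (path_image g - {pathstart g, pathfinish g})"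
    by blast
  ultimately have "x islimpt {pathstart g, pathfinish g} \<union> (path_image g - {pathstart g, pathfinish g})"
    by (rule islimpt_subset)
  then have "x islimpt path_image g - {pathstart g, pathfinish g}"
    unfolding islimpt_Un using islimpt_finite[of "{pathstart g, pathfinish g}" x] by blast
  then show ?thesis
    unfolding closure_def by blast
qed

text \<open>\<open>outside\<close> shrinks as the set grows, so the open set \<open>inside T\<close>
  misses \<open>outside S\<close> and hence its closure. For drawings: no drawn loop encloses a
  vertex that lies on the outer face.\<close>

lemma inside_disjoint_frontier_outside:
  fixes S T :: "'a::{real_normed_vector,perfect_space} set"
  assumes "closed T" "T \<subseteq> S"
  shows "inside T \<inter> frontier (outside S) = {}"
proof -
  have "open (inside T)" using assms(1) by (rule open_inside)
  moreover have "inside T \<inter> outside S = {}"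
    using outside_mono[OF assms(2)] inside_Int_outside[of T] by blast
  ultimately show ?thesis
    using open_Int_closure_eq_empty by (auto simp: frontier_def)
qed

text \<open>A smaller drawing has a larger outside, and a point of the smaller set cannot belong to
  that outside itself. So vertices stay on the outer face in subdrawings.\<close>

lemma frontier_outside_antimono:
  fixes S T :: "'a::{real_normed_vector,perfect_space} set"
  assumes "closed T" "T \<subseteq> S" "x \<in> T" "x \<in> frontier (outside S)"
  shows "x \<in> frontier (outside T)"
proof -
  have "x \<in> closure (outside T)"
    using closure_mono[OF outside_mono[OF assms(2)]] assms(4) by (auto simp: frontier_def)
  moreover have "x \<notin> outside T" using assms(3) outside_no_overlap[of T] by blast
  ultimately show ?thesis
    using open_outside[OF assms(1)] by (auto simp: frontier_def interior_open)
qed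

text \<open>The arcs \<open>hab\<close>, \<open>hbc\<close>, \<open>hcd\<close>, \<open>hda\<close>
  form a closed curve with diagonals \<open>hac\<close> and \<open>hbd\<close>. With either diagonal
  it is a theta curve, and as no corner is enclosed, the diagonal must run inside the closed curve.
  The first diagonal splits this inside into two regions; the second stays in one of them, so its
  end on the other side would be enclosed.\<close>

lemma K4_subdivision_not_on_outer_face:
  fixes a b c d :: complex
  assumes ab: "arc hab" "pathstart hab = a" "pathfinish hab = b"
    and bc: "arc hbc" "pathstart hbc = b" "pathfinish hbc = c"
    and cd: "arc hcd" "pathstart hcd = c" "pathfinish hcd = d"
    and da: "arc hda" "pathstart hda = d" "pathfinish hda = a"
    and ac: "arc hac" "pathstart hac = a" "pathfinish hac = c"
    and bd: "arc hbd" "pathstart hbd = b" "pathfinish hbd = d"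
    and ab_bc: "path_image hab \<inter> path_image hbc \<subseteq> {b}"
    and ab_cd: "path_image hab \<inter> path_image hcd \<subseteq> {}"
    and ab_da: "path_image hab \<inter> path_image hda \<subseteq> {a}"
    and ab_ac: "path_image hab \<inter> path_image hac \<subseteq> {a}"
    and ab_bd: "path_image hab \<inter> path_image hbd \<subseteq> {b}"
    and bc_cd: "path_image hbc \<inter> path_image hcd \<subseteq> {c}"
    and bc_da: "path_image hbc \<inter> path_image hda \<subseteq> {}"
    and bc_ac: "path_image hbc \<inter> path_image hac \<subseteq> {c}"
    and bc_bd: "path_image hbc \<inter> path_image hbd \<subseteq> {b}"
    and cd_da: "path_image hcd \<inter> path_image hda \<subseteq> {d}"
    and cd_ac: "path_image hcd \<inter> path_image hac \<subseteq> {c}"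
    and cd_bd: "path_image hcd \<inter> path_image hbd \<subseteq> {d}"
    and da_ac: "path_image hda \<inter> path_image hac \<subseteq> {a}"
    and da_bd: "path_image hda \<inter> path_image hbd \<subseteq> {d}"
    and ac_bd: "path_image hac \<inter> path_image hbd \<subseteq> {}"
    and S: "path_image hab \<union> path_image hbc \<union> path_image hcd \<union> path_image hda
              \<union> path_image hac \<union> path_image hbd \<subseteq> S"
  shows "\<not> {a, b, c, d} \<subseteq> frontier (outside S)"
proof
  assume outer: "{a, b, c, d} \<subseteq> frontier (outside S)"
  have ends: "a \<in> path_image hab" "b \<in> path_image hab" "b \<in> path_image hbc" "c \<in> path_image hbc"
      "c \<in> path_image hcd" "d \<in> path_image hcd" "d \<in> path_image hda" "a \<in> path_image hda"
      "a \<in> path_image hac" "c \<in> path_image hac" "b \<in> path_image hbd" "d \<in> path_image hbd"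
    using ab bc cd da ac bd pathstart_in_path_image pathfinish_in_path_image by metis+
  have ne: "a \<noteq> b" "b \<noteq> c" "c \<noteq> d" "d \<noteq> a" "a \<noteq> c" "b \<noteq> d"
    using ab bc cd da ac bd arc_distinct_ends by metis+
  have not_inside: "x \<notin> inside T" if "x \<in> {a, b, c, d}" "T \<subseteq> S" "closed T" for x T
    using inside_disjoint_frontier_outside[OF that(3,2)] outer that(1) by blast
  have closed: "closed (path_image g)" if "arc g" for g :: "real \<Rightarrow> complex"
    using that by (simp add: closed_arc_image)
  note clo = closed[OF ab(1)] closed[OF bc(1)] closed[OF cd(1)] closed[OF da(1)]
    closed[OF ac(1)] closed[OF bd(1)]
  \<comment> \<open>The closed curve is halved at \<open>a\<close>, \<open>c\<close> and again at
    \<open>b\<close>, \<open>d\<close>. The reversals give the three arcs of each theta curve the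
    same start and the same finish.\<close>
  define abc where "abc = hab +++ hbc"
  define adc where "adc = reversepath (hcd +++ hda)"
  define bcd where "bcd = hbc +++ hcd"
  define bad where "bad = reversepath (hda +++ hab)"
  have img: "path_image abc = path_image hab \<union> path_image hbc"
     "path_image adc = path_image hcd \<union> path_image hda"
     "path_image bcd = path_image hbc \<union> path_image hcd"
     "path_image bad = path_image hda \<union> path_image hab"
    using ab bc cd da by (simp_all add: abc_def adc_def bcd_def bad_def path_image_join)
  have abc: "arc abc" "pathstart abc = a" "pathfinish abc = c"
    using ab bc ab_bc by (auto simp: abc_def intro!: arc_join)
  have adc: "arc adc" "pathstart adc = a" "pathfinish adc = c"
    using cd da cd_da by (auto simp: adc_def intro!: arc_join arc_reversepath)
  have bcd: "arc bcd" "pathstart bcd = b" "pathfinish bcd = d"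
    using bc cd bc_cd by (auto simp: bcd_def intro!: arc_join)
  have bad: "arc bad" "pathstart bad = b" "pathfinish bad = d"
    using da ab ab_da by (auto simp: bad_def intro!: arc_join arc_reversepath)
  let ?C = "path_image abc \<union> path_image adc"
  have i1: "path_image abc \<inter> path_image adc = {a, c}"
    using ends ab_cd ab_da bc_cd bc_da by (auto simp: img)
  have i2: "path_image abc \<inter> path_image hac = {a, c}"
    using ends ab_ac bc_ac by (auto simp: img)
  have i3: "path_image adc \<inter> path_image hac = {a, c}"
    using ends cd_ac da_ac by (auto simp: img)
  have j1: "path_image bcd \<inter> path_image bad = {b, d}"
    using ends ab_bc ab_cd bc_da cd_da by (auto simp: img)
  have j2: "path_image bcd \<inter> path_image hbd = {b, d}"
    using ends bc_bd cd_bd by (auto simp: img)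
  have j3: "path_image bad \<inter> path_image hbd = {b, d}"
    using ends da_bd ab_bd by (auto simp: img)
  have "b \<notin> inside (path_image adc \<union> path_image hac)" "d \<notin> inside (path_image abc \<union> path_image hac)"
    using not_inside[of b "path_image adc \<union> path_image hac"]
      not_inside[of d "path_image abc \<union> path_image hac"] S clo by (simp_all add: img closed_Un)
  then have ac_inside: "path_image hac - {a, c} \<subseteq> inside ?C"
    using theta_curve_cases[OF abc adc ac i1 i2 i3] ends ne by (auto simp: img)
  have "a \<notin> inside (path_image bcd \<union> path_image hbd)" "c \<notin> inside (path_image bad \<union> path_image hbd)"
    using not_inside[of a "path_image bcd \<union> path_image hbd"]
      not_inside[of c "path_image bad \<union> path_image hbd"] S clo by (simp_all add: img closed_Un)
  then have "path_image hbd - {b, d} \<subseteq> inside (path_image bcd \<union> path_image bad)"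
    using theta_curve_cases[OF bcd bad bd j1 j2 j3] ends ne by (auto simp: img)
  moreover have "path_image bcd \<union> path_image bad = ?C" by (auto simp: img)
  ultimately have bd_inside: "path_image hbd - {b, d} \<subseteq> inside ?C" by simp
  let ?I1 = "inside (path_image abc \<union> path_image hac)"
  let ?I2 = "inside (path_image adc \<union> path_image hac)"
  have "path_image hac - {a, c} \<noteq> {}"
    using arc_end_in_closure_interior[OF ac(1) ends(9)] ac by (metis closure_empty empty_iff)
  then have "path_image hac \<inter> inside ?C \<noteq> {}" using ac_inside by blast
  then have split: "?I1 \<inter> ?I2 = {}" "?I1 \<union> ?I2 \<union> (path_image hac - {a, c}) = inside ?C"
    using split_inside_simple_closed_curve
      [OF arc_imp_simple_path[OF abc(1)] abc(2,3) arc_imp_simple_path[OF adc(1)] adc(2,3)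
        arc_imp_simple_path[OF ac(1)] ac(2,3) ne(5) i1 i2 i3] by blast+
  let ?Y = "path_image hbd - {b, d}"
  have Y: "connected ?Y" "b \<in> closure ?Y" "d \<in> closure ?Y"
    using connected_simple_path_endless[OF arc_imp_simple_path[OF bd(1)]]
      arc_end_in_closure_interior[OF bd(1) ends(11)] arc_end_in_closure_interior[OF bd(1) ends(12)]
      bd by auto
  have "?Y \<subseteq> ?I1 \<union> ?I2" using bd_inside split(2) ac_bd by blast
  have op: "open ?I1" "open ?I2"
    using clo by (auto simp: img intro!: open_inside closed_Un)
  consider "?Y \<subseteq> ?I1" | "?Y \<subseteq> ?I2"
    using connectedD[OF Y(1) op] \<open>?Y \<subseteq> ?I1 \<union> ?I2\<close> split(1) by blast
  \<comment> \<open>The end of \<open>hbd\<close> opposite to its region lies in the closure of that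
    region but not on the bounding loop, hence in the region itself.\<close>
  then show False
  proof cases
    case 1
    have "d \<in> (path_image abc \<union> path_image hac) \<union> ?I1"
      using Y(3) closure_mono[OF 1] closure_inside_subset[of "path_image abc \<union> path_image hac"] clo
      by (auto simp: img closed_Un)
    then have "d \<in> ?I1"
      using ends ne ab_cd ab_da bc_cd cd_ac by (auto simp: img)
    then show False
      using not_inside[of d "path_image abc \<union> path_image hac"] S clo by (auto simp: img closed_Un)
  next
    case 2
    have "b \<in> (path_image adc \<union> path_image hac) \<union> ?I2"
      using Y(2) closure_mono[OF 2] closure_inside_subset[of "path_image adc \<union> path_image hac"] clo
      by (auto simp: img closed_Un)
    then have "b \<in> ?I2"
      using ends ne ab_cd ab_da bc_cd ab_ac by (auto simp: img)
    then show False
      using not_inside[of b "path_image adc \<union> path_image hac"] S clo by (auto simp: img closed_Un)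
  qed
qed

section \<open>Paths in drawn graphs\<close>

definition graph_path :: "'a graph \<Rightarrow> 'a list \<Rightarrow> bool" where
  "graph_path G vs \<longleftrightarrow> distinct vs \<and> set vs \<subseteq> verts G \<and> successively (\<lambda>u v. {u, v} \<in> edges G) vs"

fun path_edges :: "'a list \<Rightarrow> 'a set set" where
  "path_edges (u # v # vs) = insert {u, v} (path_edges (v # vs))"
| "path_edges _ = {}"

lemma path_edges_subset: "successively (\<lambda>u v. {u, v} \<in> edges G) vs \<Longrightarrow> path_edges vs \<subseteq> edges G"
  by (induction vs rule: path_edges.induct) auto

lemma path_edge_subset_set: "e \<in> path_edges vs \<Longrightarrow> e \<subseteq> set vs"
  by (induction vs rule: path_edges.induct) auto

text \<open>The edge arcs are joined one by one. The first vertex lies on no later edge, so the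
  first arc meets the remaining ones only at its other end, and the join is again an arc.\<close>

lemma graph_path_arc:
  assumes "plane_drawing G p \<gamma>" "graph_path G vs" "2 \<le> length vs"
  obtains g where "arc g" "pathstart g = p (hd vs)" "pathfinish g = p (last vs)"
    "path_image g = (\<Union>e\<in>path_edges vs. path_image (\<gamma> e))"
proof -
  note D = assms(1)[unfolded plane_drawing_def]
  \<comment> \<open>A drawing prescribes the ends of an edge only as a set, so the arc may have to
    be reversed.\<close>
  have edge: "\<exists>g. arc g \<and> pathstart g = p u \<and> pathfinish g = p v \<and> path_image g = path_image (\<gamma> {u, v})"
    if "{u, v} \<in> edges G" for u v
  proof -
    have "arc (\<gamma> {u, v})" "{pathstart (\<gamma> {u, v}), pathfinish (\<gamma> {u, v})} = {p u, p v}"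
      using D that by auto
    then show ?thesis
      by (metis arc_reversepath doubleton_eq_iff path_image_reversepath pathfinish_reversepath
          pathstart_reversepath)
  qed
  have "\<exists>g. arc g \<and> pathstart g = p (hd vs) \<and> pathfinish g = p (last vs) \<and>
      path_image g = (\<Union>e\<in>path_edges vs. path_image (\<gamma> e))"
    using assms(2,3)
  proof (induction vs rule: path_edges.induct)
    case (1 u v vs)
    show ?case
    proof (cases "vs = []")
      case True
      then show ?thesis using 1(2) edge[of u v] by (auto simp: graph_path_def)
    next
      case False
      have path: "graph_path G (v # vs)" using 1(2) by (auto simp: graph_path_def)
      then obtain g where g: "arc g" "pathstart g = p v" "pathfinish g = p (last vs)"
          "path_image g = (\<Union>e\<in>path_edges (v # vs). path_image (\<gamma> e))"
        using 1(1) False by (auto simp: Suc_le_eq)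
      have uv: "{u, v} \<in> edges G" using 1(2) by (auto simp: graph_path_def)
      then obtain f where f: "arc f" "pathstart f = p u" "pathfinish f = p v"
          "path_image f = path_image (\<gamma> {u, v})" using edge by blast
      have "path_image (\<gamma> {u, v}) \<inter> path_image (\<gamma> e) \<subseteq> {p v}" if e: "e \<in> path_edges (v # vs)" for e
      proof -
        have "u \<notin> e" using path_edge_subset_set[OF e] 1(2) by (auto simp: graph_path_def)
        moreover have "e \<in> edges G" using path_edges_subset[of G "v # vs"] e path by (auto simp: graph_path_def)
        ultimately have "path_image (\<gamma> {u, v}) \<inter> path_image (\<gamma> e) \<subseteq> p ` ({u, v} \<inter> e)"
          using D uv by blast
        then show ?thesis using \<open>u \<notin> e\<close> by blast
      qed
      then have "path_image (\<gamma> {u, v}) \<inter> (\<Union>e\<in>path_edges (v # vs). path_image (\<gamma> e)) \<subseteq> {p v}"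
        by blast
      then have "path_image f \<inter> path_image g \<subseteq> {pathstart g}" by (simp only: f(4) g(2,4))
      then have "arc (f +++ g)" using f g by (intro arc_join) auto
      then show ?thesis using f g False
        by (intro exI[of _ "f +++ g"]) (auto simp: path_image_join)
    qed
  qed (auto simp: graph_path_def)
  then show ?thesis using that by blast
qed

text \<open>With at most one common vertex the paths share no edge, as an edge has two ends. So any
  edge of one path and any edge of the other meet only in common ends.\<close>

lemma path_images_meet:
  assumes D: "plane_drawing G p \<gamma>" and G: "simple_graph G"
    and vs: "graph_path G vs" and ws: "graph_path G ws"
    and meet: "set vs \<inter> set ws \<subseteq> {x}"
  shows "(\<Union>e\<in>path_edges vs. path_image (\<gamma> e)) \<inter> (\<Union>e\<in>path_edges ws. path_image (\<gamma> e))
    \<subseteq> p ` (set vs \<inter> set ws)"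
proof -
  have "path_image (\<gamma> e) \<inter> path_image (\<gamma> f) \<subseteq> p ` (set vs \<inter> set ws)"
    if ef: "e \<in> path_edges vs" "f \<in> path_edges ws" for e f
  proof -
    have E: "e \<in> edges G" "f \<in> edges G"
      using ef vs ws path_edges_subset unfolding graph_path_def by blast+
    have sub: "e \<subseteq> set vs" "f \<subseteq> set ws" using ef path_edge_subset_set by auto
    have "e \<noteq> f"
    proof
      assume "e = f"
      then have "e \<subseteq> {x}" using sub meet by blast
      then have "card e \<le> 1" using card_mono[of "{x}" e] by simp
      then show False using G E by (auto simp: simple_graph_def)
    qed
    then have "path_image (\<gamma> e) \<inter> path_image (\<gamma> f) \<subseteq> p ` (e \<inter> f)"
      using D E by (auto simp: plane_drawing_def)
    then show ?thesis using sub by blast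
  qed
  then show ?thesis by blast
qed

lemma finite_edges: "simple_graph G \<Longrightarrow> finite (edges G)"
  by (rule finite_subset[of _ "Pow (verts G)"]) (auto simp: simple_graph_def)

lemma outerplanar_no_K4_subdivision:
  assumes G: "outerplanar G"
    and paths: "graph_path G ab" "graph_path G bc" "graph_path G cd" "graph_path G da"
      "graph_path G ac" "graph_path G bd"
    and ab: "hd ab = a" "last ab = b" and bc: "hd bc = b" "last bc = c"
    and cd: "hd cd = c" "last cd = d" and da: "hd da = d" "last da = a"
    and ac: "hd ac = a" "last ac = c" and bd: "hd bd = b" "last bd = d"
    and lens: "2 \<le> length ab" "2 \<le> length bc" "2 \<le> length cd" "2 \<le> length da"
      "2 \<le> length ac" "2 \<le> length bd"
    and meets: "set ab \<inter> set bc \<subseteq> {b}" "set ab \<inter> set cd \<subseteq> {}" "set ab \<inter> set da \<subseteq> {a}"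
      "set ab \<inter> set ac \<subseteq> {a}" "set ab \<inter> set bd \<subseteq> {b}" "set bc \<inter> set cd \<subseteq> {c}"
      "set bc \<inter> set da \<subseteq> {}" "set bc \<inter> set ac \<subseteq> {c}" "set bc \<inter> set bd \<subseteq> {b}"
      "set cd \<inter> set da \<subseteq> {d}" "set cd \<inter> set ac \<subseteq> {c}" "set cd \<inter> set bd \<subseteq> {d}"
      "set da \<inter> set ac \<subseteq> {a}" "set da \<inter> set bd \<subseteq> {d}" "set ac \<inter> set bd \<subseteq> {}"
  shows False
proof -
  obtain p \<gamma> where D: "plane_drawing G p \<gamma>" and outer: "p ` verts G \<subseteq> frontier (outside (drawn_set G p \<gamma>))"
    and sg: "simple_graph G"
    using G unfolding outerplanar_def by blast
  \<comment> \<open>\<open>X\<close> is a singleton for paths with a common end and empty for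
    disjoint ones; \<open>{x}\<close> bounds it in both cases.\<close>
  have meet: "path_image f \<inter> path_image g \<subseteq> p ` X"
    if "path_image f = (\<Union>e\<in>path_edges vs. path_image (\<gamma> e))"
      "path_image g = (\<Union>e\<in>path_edges ws. path_image (\<gamma> e))"
      "graph_path G vs" "graph_path G ws" "set vs \<inter> set ws \<subseteq> X" "X \<subseteq> {x}" for f g vs ws X x
    unfolding that(1,2)
    using path_images_meet[OF D sg that(3,4) order_trans[OF that(5,6)]] image_mono[OF that(5), of p]
    by (rule order_trans)
  have sub: "path_image f \<subseteq> drawn_set G p \<gamma>"
    if "path_image f = (\<Union>e\<in>path_edges vs. path_image (\<gamma> e))" "graph_path G vs" for f vs
    using that path_edges_subset[of G vs] by (auto simp: drawn_set_def graph_path_def)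
  obtain gab where gab: "arc gab" "pathstart gab = p a" "pathfinish gab = p b"
    "path_image gab = (\<Union>e\<in>path_edges ab. path_image (\<gamma> e))"
    using graph_path_arc[OF D paths(1) lens(1)] ab by metis
  obtain gbc where gbc: "arc gbc" "pathstart gbc = p b" "pathfinish gbc = p c"
    "path_image gbc = (\<Union>e\<in>path_edges bc. path_image (\<gamma> e))"
    using graph_path_arc[OF D paths(2) lens(2)] bc by metis
  obtain gcd' where gcd: "arc gcd'" "pathstart gcd' = p c" "pathfinish gcd' = p d"
    "path_image gcd' = (\<Union>e\<in>path_edges cd. path_image (\<gamma> e))"
    using graph_path_arc[OF D paths(3) lens(3)] cd by metis
  obtain gda where gda: "arc gda" "pathstart gda = p d" "pathfinish gda = p a"
    "path_image gda = (\<Union>e\<in>path_edges da. path_image (\<gamma> e))"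
    using graph_path_arc[OF D paths(4) lens(4)] da by metis
  obtain gac where gac: "arc gac" "pathstart gac = p a" "pathfinish gac = p c"
    "path_image gac = (\<Union>e\<in>path_edges ac. path_image (\<gamma> e))"
    using graph_path_arc[OF D paths(5) lens(5)] ac by metis
  obtain gbd where gbd: "arc gbd" "pathstart gbd = p b" "pathfinish gbd = p d"
    "path_image gbd = (\<Union>e\<in>path_edges bd. path_image (\<gamma> e))"
    using graph_path_arc[OF D paths(6) lens(6)] bd by metis
  note imgs = gab(4) gbc(4) gcd(4) gda(4) gac(4) gbd(4)
  note images_meet =
    meet[OF imgs(1,2) paths(1,2) meets(1) subset_refl]
    meet[OF imgs(1,3) paths(1,3) meets(2) empty_subsetI]
    meet[OF imgs(1,4) paths(1,4) meets(3) subset_refl]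
    meet[OF imgs(1,5) paths(1,5) meets(4) subset_refl]
    meet[OF imgs(1,6) paths(1,6) meets(5) subset_refl]
    meet[OF imgs(2,3) paths(2,3) meets(6) subset_refl]
    meet[OF imgs(2,4) paths(2,4) meets(7) empty_subsetI]
    meet[OF imgs(2,5) paths(2,5) meets(8) subset_refl]
    meet[OF imgs(2,6) paths(2,6) meets(9) subset_refl]
    meet[OF imgs(3,4) paths(3,4) meets(10) subset_refl]
    meet[OF imgs(3,5) paths(3,5) meets(11) subset_refl]
    meet[OF imgs(3,6) paths(3,6) meets(12) subset_refl]
    meet[OF imgs(4,5) paths(4,5) meets(13) subset_refl]
    meet[OF imgs(4,6) paths(4,6) meets(14) subset_refl]
    meet[OF imgs(5,6) paths(5,6) meets(15) empty_subsetI]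
  have "\<not> {p a, p b, p c, p d} \<subseteq> frontier (outside (drawn_set G p \<gamma>))"
    using sub[OF imgs(1) paths(1)] sub[OF imgs(2) paths(2)] sub[OF imgs(3) paths(3)]
      sub[OF imgs(4) paths(4)] sub[OF imgs(5) paths(5)] sub[OF imgs(6) paths(6)]
    by (intro K4_subdivision_not_on_outer_face[OF gab(1-3) gbc(1-3) gcd(1-3) gda(1-3) gac(1-3)
          gbd(1-3) images_meet[unfolded image_insert image_empty]]) (simp only: Un_subset_iff)
  moreover have "{a, b, c, d} \<subseteq> verts G"
  proof -
    have "hd vs \<in> verts G" "last vs \<in> verts G" if "graph_path G vs" "2 \<le> length vs" for vs
      using that hd_in_set[of vs] last_in_set[of vs] by (fastforce simp: graph_path_def)+
    then show ?thesis using paths lens ab cd by blast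
  qed
  ultimately show False using outer by blast
qed

section \<open>Vertices of small degree\<close>

lemma simple_graph_edge:
  assumes "simple_graph G" "{u, v} \<in> edges G"
  shows "u \<noteq> v" "u \<in> verts G" "v \<in> verts G"
  using assms by (auto simp: simple_graph_def)

lemma open_nbh_subset: "simple_graph G \<Longrightarrow> open_nbh G v \<subseteq> verts G - {v}"
  using simple_graph_edge[of G] by (auto simp: open_nbh_def)

lemma finite_open_nbh: "simple_graph G \<Longrightarrow> finite (open_nbh G v)"
  using open_nbh_subset[of G v] by (meson finite_Diff finite_subset simple_graph_def)

lemma graph_path_rev [simp]: "graph_path G (rev vs) \<longleftrightarrow> graph_path G vs"
  by (simp add: graph_path_def successively_rev insert_commute)

lemma graph_path_appendD1: "graph_path G (vs @ ws) \<Longrightarrow> graph_path G vs"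
  and graph_path_appendD2: "graph_path G (vs @ ws) \<Longrightarrow> graph_path G ws"
  by (auto simp: graph_path_def successively_append_iff)

text \<open>On the path, \<open>x\<close> comes after \<open>t\<close>, and \<open>y\<close> is
  \<open>x\<close> or comes later. The branch vertices of the subdivided complete graph are
  \<open>hd As\<close>, \<open>last As\<close>, \<open>x\<close> and \<open>t\<close>. Their
  connections are \<open>As\<close>, the edge from \<open>last As\<close> to \<open>y\<close>
  continued back along the path to \<open>x\<close>, the path from \<open>x\<close> back to
  \<open>t\<close>, the two chords at \<open>hd As\<close>, and the path edge from
  \<open>last As\<close> to \<open>t\<close>.\<close>

lemma outerplanar_no_crossing_chords:
  assumes G: "outerplanar G" and path: "graph_path G (As @ t # Ds @ x # Es)"
    and split: "x # Es = Gs @ y # Hs" and len: "2 \<le> length As"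
    and chords: "{hd As, t} \<in> edges G" "{hd As, x} \<in> edges G" "{last As, y} \<in> edges G"
  shows False
proof -
  have "As \<noteq> []" using len by auto
  then have As: "As \<noteq> []" "hd As \<in> set As" "last As \<in> set As" by auto
  have "hd As \<noteq> last As"
    using path len by (cases As) (auto simp: graph_path_def)
  have lt: "{last As, t} \<in> edges G"
    using path As by (simp add: graph_path_def successively_append_iff)
  have path': "graph_path G (As @ t # Ds @ Gs @ y # Hs)" using path split by simp
  have x: "x = hd (Gs @ [y])" using split by (cases Gs) auto
  have bc: "graph_path G (last As # y # rev Gs)"
  proof -
    have "graph_path G (Gs @ [y])"
      using path' graph_path_appendD1[of G "Gs @ [y]" Hs] graph_path_appendD2[of G "As @ t # Ds"] by simp
    then have "graph_path G (y # rev Gs)" using graph_path_rev[of G "Gs @ [y]"] by simp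
    moreover have "last As \<notin> insert y (set Gs)" "last As \<in> verts G"
      using path' As(3) by (auto simp: graph_path_def)
    ultimately show ?thesis using chords(3) by (simp add: graph_path_def)
  qed
  have cd: "graph_path G (x # rev Ds @ [t])"
  proof -
    have "graph_path G (t # Ds @ [x])"
      using path graph_path_appendD1[of G "t # Ds @ [x]" Es] graph_path_appendD2[of G As] by simp
    then show ?thesis using graph_path_rev[of G "t # Ds @ [x]"] by simp
  qed
  have dist: "distinct (As @ t # Ds @ Gs @ y # Hs)" using path' by (simp add: graph_path_def)
  have "x \<in> insert y (set Gs)" using x by (cases Gs) auto
  then have "x \<notin> set As" "x \<notin> set Ds" "x \<noteq> t" using dist by auto
  moreover have "hd As \<notin> set Ds \<union> set Gs" "last As \<notin> set Ds \<union> set Gs"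
    using dist As(2,3) by auto
  ultimately have notin: "x \<notin> set As" "x \<notin> set Ds" "x \<noteq> t" "hd As \<notin> set Ds" "hd As \<notin> set Gs"
    "last As \<notin> set Ds" "last As \<notin> set Gs" by auto
  have neqs: "hd As \<noteq> last As" "x \<noteq> t" "x \<noteq> hd As" "x \<noteq> last As"
    using \<open>hd As \<noteq> last As\<close> notin As(2,3) by auto
  show False
  proof (rule outerplanar_no_K4_subdivision[where a = "hd As" and b = "last As" and c = x and d = t,
        OF G graph_path_appendD1[OF path] bc cd])
    show "graph_path G [t, hd As]" "graph_path G [hd As, x]" "graph_path G [last As, t]"
      using path chords lt As by (auto simp: graph_path_def insert_commute)
    show "last (last As # y # rev Gs) = x" using x by (cases Gs) auto
  qed (use dist len As(1) in \<open>auto simp: notin neqs neqs[symmetric]\<close>)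
qed

lemma outerplanar_low_degree:
  assumes G: "outerplanar G" and "verts G \<noteq> {}"
  shows "\<exists>v\<in>verts G. card (open_nbh G v) \<le> 2"
proof (rule ccontr)
  assume no_low: "\<not> ?thesis"
  then have deg: "2 < card (open_nbh G v)" if "v \<in> verts G" for v
    using that no_low by (meson not_le)
  have sg: "simple_graph G" using G by (simp add: outerplanar_def)
  define longest where
    "longest vs \<longleftrightarrow> graph_path G vs \<and> (\<forall>ws. graph_path G ws \<longrightarrow> length ws \<le> length vs)" for vs
  obtain v0 where v0: "v0 \<in> verts G" using assms(2) by blast
  have "length ws \<le> card (verts G)" if "graph_path G ws" for ws
    using that sg card_mono[of "verts G" "set ws"]
    by (simp add: graph_path_def simple_graph_def distinct_card)
  then obtain vs0 where vs0: "longest vs0"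
    using ex_has_greatest_nat[of "graph_path G" "[v0]" length "Suc (card (verts G))"] v0
    by (auto simp: longest_def graph_path_def less_Suc_eq_le)
  have long: "2 \<le> length vs" "hd vs \<in> verts G" if vs: "longest vs" for vs
  proof -
    have "open_nbh G v0 \<noteq> {}" using deg[OF v0] by auto
    then obtain u where "{u, v0} \<in> edges G" by (auto simp: open_nbh_def)
    then have "graph_path G [u, v0]" using simple_graph_edge[OF sg] by (auto simp: graph_path_def)
    then show "2 \<le> length vs" using vs unfolding longest_def by fastforce
    then show "hd vs \<in> verts G"
      using vs hd_in_set[of vs] by (fastforce simp: longest_def graph_path_def)
  qed
  have on_path: "u \<in> set vs" if vs: "longest vs" and u: "{hd vs, u} \<in> edges G" for vs u
  proof (rule ccontr)
    assume "u \<notin> set vs"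
    then have "graph_path G (u # vs)"
      using vs u long[OF vs] simple_graph_edge[OF sg u]
      by (cases vs) (auto simp: longest_def graph_path_def insert_commute)
    then show False using vs by (fastforce simp: longest_def)
  qed
  \<comment> \<open>Of at least three neighbours, one differs from \<open>vs ! 1\<close> and from a
    prescribed \<open>w\<close>. It is on the path because the path is longest, and it is not the
    head, so its index is at least 2.\<close>
  have third: "\<exists>j<length vs. 2 \<le> j \<and> vs ! j \<noteq> w \<and> {hd vs, vs ! j} \<in> edges G"
    if vs: "longest vs" for vs w
  proof -
    have "card {vs ! 1, w} \<le> 2" by (simp add: card_insert_if)
    then have "\<not> open_nbh G (hd vs) \<subseteq> {vs ! 1, w}"
      using deg[OF long(2)[OF vs]] card_mono[of "{vs ! 1, w}" "open_nbh G (hd vs)"] by fastforce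
    then obtain u where u: "{hd vs, u} \<in> edges G" "u \<noteq> vs ! 1" "u \<noteq> w"
      by (auto simp: open_nbh_def insert_commute)
    obtain j where j: "j < length vs" "u = vs ! j"
      using on_path[OF vs u(1)] by (auto simp: in_set_conv_nth)
    have "j \<noteq> 0"
      using simple_graph_edge(1)[OF sg u(1)] j long[OF vs] by (cases j) (auto simp: hd_conv_nth)
    moreover have "j \<noteq> 1" using u j by auto
    ultimately show ?thesis using j u by (intro exI[of _ j]) auto
  qed
  define chord where "chord i \<longleftrightarrow> (\<exists>vs. longest vs \<and> 2 \<le> i \<and> i < length vs \<and> {hd vs, vs ! i} \<in> edges G)" for i
  define i where "i = (LEAST i. chord i)"
  obtain j where "chord j" using third[OF vs0, of "hd vs0"] vs0 unfolding chord_def by blast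
  then have "chord i" unfolding i_def by (rule LeastI)
  then obtain vs where vs: "longest vs" "2 \<le> i" "i < length vs" "{hd vs, vs ! i} \<in> edges G"
    by (auto simp: chord_def)
  define As t Cs where "As = take i vs" and "t = vs ! i" and "Cs = drop (Suc i) vs"
  have dec: "vs = As @ t # Cs" and lenAs: "length As = i" "2 \<le> length As"
    using vs by (auto simp: As_def t_def Cs_def id_take_nth_drop[symmetric])
  \<comment> \<open>The index given by \<open>third\<close> is at least \<open>i\<close> by
    minimality, and not \<open>i\<close> because \<open>t\<close> is excluded. This is applied to
    \<open>As\<close> and to \<open>rev As\<close>, which are followed by the same \<open>t\<close>
    and \<open>Cs\<close>.\<close>
  have beyond: "\<exists>x\<in>set Cs. {hd Bs, x} \<in> edges G"
    if Bs: "longest (Bs @ t # Cs)" "length Bs = i" for Bs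
  proof -
    obtain j where j: "j < length (Bs @ t # Cs)" "2 \<le> j" "(Bs @ t # Cs) ! j \<noteq> t"
        "{hd (Bs @ t # Cs), (Bs @ t # Cs) ! j} \<in> edges G"
      using third[OF Bs(1)] by blast
    then have "i \<le> j" unfolding i_def using Bs(1) by (intro Least_le) (auto simp: chord_def)
    moreover have "j \<noteq> i" using j(3) Bs(2) by (metis nth_append_length)
    ultimately have "(Bs @ t # Cs) ! j = Cs ! (j - Suc i)" "j - Suc i < length Cs"
      using Bs(2) j(1) by (auto simp: nth_append nth_Cons')
    moreover have "hd (Bs @ t # Cs) = hd Bs" using Bs(2) vs(2) by (cases Bs) auto
    ultimately show ?thesis using j(4) by (intro bexI[of _ "Cs ! (j - Suc i)"]) auto
  qed
  have ht: "{hd As, t} \<in> edges G" using vs(4) dec lenAs by (metis hd_append2 list.size(3) not_numeral_le_zero t_def)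
  have As: "As \<noteq> []" using lenAs by auto
  have path: "graph_path G (As @ t # Cs)" using vs(1) dec by (simp add: longest_def)
  then have lt: "{last As, t} \<in> edges G"
    using As by (auto simp: graph_path_def successively_append_iff)
  have rpath: "graph_path G (rev As @ t # Cs)"
  proof -
    have "graph_path G (rev As)" using graph_path_appendD1[OF path] by simp
    then show ?thesis
      using path ht As by (auto simp: graph_path_def successively_append_iff last_rev)
  qed
  have "longest (rev As @ t # Cs)" using rpath vs(1) dec by (simp add: longest_def)
  from beyond[OF this] lenAs(1) obtain y where y: "y \<in> set Cs" "{last As, y} \<in> edges G"
    using As by (auto simp: hd_rev)
  obtain x where x: "x \<in> set Cs" "{hd As, x} \<in> edges G"
    using beyond[of As] vs(1) dec lenAs(1) by auto
  obtain Ds Es where xs: "Cs = Ds @ x # Es" using split_list[OF x(1)] by blast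
  show False
  proof (cases "y \<in> set (x # Es)")
    case True
    then obtain Gs Hs where "x # Es = Gs @ y # Hs" using split_list by metis
    then show False
      by (rule outerplanar_no_crossing_chords[OF G path[unfolded xs append_Cons append_assoc] _ lenAs(2) ht x(2) y(2)])
  next
    \<comment> \<open>If \<open>y\<close> comes before \<open>x\<close>, reversing \<open>As\<close>
      exchanges its ends and thereby the roles of \<open>x\<close> and \<open>y\<close>.\<close>
    case False
    then have "y \<in> set Ds" using y(1) xs by auto
    then obtain Gs Hs where "Ds = Gs @ y # Hs" using split_list by metis
    moreover have "hd (rev As) = last As" "last (rev As) = hd As" using As by (simp_all add: hd_rev last_rev)
    ultimately show False
      using rpath xs lenAs(2) lt x(2) y(2)
      by (intro outerplanar_no_crossing_chords[OF G, of "rev As" t Gs y "Hs @ x # Es" "y # Hs" x Es])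
         simp_all
  qed
qed

section \<open>Eliminating a vertex\<close>

lemma closed_drawn_set:
  assumes "simple_graph G" "plane_drawing G p \<gamma>"
  shows "closed (drawn_set G p \<gamma>)"
proof -
  have "closed (\<Union>e\<in>edges G. path_image (\<gamma> e))"
    using assms finite_edges[of G]
    by (intro closed_UN) (auto simp: plane_drawing_def closed_arc_image)
  then show ?thesis
    using finite_imp_closed[of "p ` verts G"] assms(1)
    unfolding drawn_set_def simple_graph_def by (intro closed_Un) auto
qed

text \<open>The arcs \<open>\<gamma>'\<close> may be new, as an added edge is drawn along deleted
  ones; only the drawn points must be old.\<close>

lemma outerplanar_subdrawing:
  assumes outer: "p ` verts G \<subseteq> frontier (outside (drawn_set G p \<gamma>))"
    and H: "simple_graph H" "plane_drawing H p \<gamma>'"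
    and sub: "verts H \<subseteq> verts G" "drawn_set H p \<gamma>' \<subseteq> drawn_set G p \<gamma>"
  shows "outerplanar H"
proof -
  have "p ` verts H \<subseteq> frontier (outside (drawn_set H p \<gamma>'))"
    using frontier_outside_antimono[OF closed_drawn_set[OF H] sub(2)] outer sub(1)
    by (auto simp: drawn_set_def)
  then show ?thesis using H by (auto simp: outerplanar_def)
qed

text \<open>A neighbourhood with two elements is itself the edge to be added, so the neighbours need
  not be named. This edge will force their colours to differ.\<close>

definition eliminate :: "'a graph \<Rightarrow> 'a \<Rightarrow> 'a graph" where
  "eliminate G v = \<lparr>verts = verts G - {v},
     edges = {e \<in> edges G. v \<notin> e} \<union> {e. e = open_nbh G v \<and> card e = 2}\<rparr>"

lemma outerplanar_eliminate:
  assumes G: "outerplanar G" and v: "v \<in> verts G"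
  shows "outerplanar (eliminate G v)"
proof -
  obtain p \<gamma> where D: "plane_drawing G p \<gamma>" and outer: "p ` verts G \<subseteq> frontier (outside (drawn_set G p \<gamma>))"
    and sg: "simple_graph G"
    using G unfolding outerplanar_def by blast
  have inj: "inj_on p (verts G)"
    and arcs: "\<And>e. e \<in> edges G \<Longrightarrow> arc (\<gamma> e) \<and> {pathstart (\<gamma> e), pathfinish (\<gamma> e)} = p ` e"
    and avoid: "\<And>e. e \<in> edges G \<Longrightarrow> path_image (\<gamma> e) \<inter> p ` verts G \<subseteq> p ` e"
    and cross: "\<And>e f. e \<in> edges G \<Longrightarrow> f \<in> edges G \<Longrightarrow> e \<noteq> f \<Longrightarrow>
        path_image (\<gamma> e) \<inter> path_image (\<gamma> f) \<subseteq> p ` (e \<inter> f)"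
    using D by (simp_all add: plane_drawing_def)
  have sH: "simple_graph (eliminate G v)"
    using sg open_nbh_subset[OF sg, of v] by (auto simp: simple_graph_def eliminate_def)
  have vH: "verts (eliminate G v) \<subseteq> verts G" by (auto simp: eliminate_def)
  show ?thesis
  proof (cases "edges (eliminate G v) \<subseteq> edges G")
    case True
    have "path_image (\<gamma> e) \<inter> p ` verts (eliminate G v) \<subseteq> p ` e"
      if "e \<in> edges (eliminate G v)" for e
      using avoid[of e] True that vH by blast
    then have "plane_drawing (eliminate G v) p \<gamma>"
      using True arcs cross inj_on_subset[OF inj vH] by (simp add: plane_drawing_def subset_iff)
    moreover have "drawn_set (eliminate G v) p \<gamma> \<subseteq> drawn_set G p \<gamma>"
      using True vH by (auto simp: drawn_set_def)
    ultimately show ?thesis by (rule outerplanar_subdrawing[OF outer sH _ vH])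
  next
    case False
    then have "card (open_nbh G v) = 2" and new: "open_nbh G v \<notin> edges G"
      by (auto simp: eliminate_def)
    then obtain x y where N: "open_nbh G v = {x, y}" "x \<noteq> y" by (auto simp: card_2_iff)
    then have E: "{x, v} \<in> edges G" "{v, y} \<in> edges G"
      using open_nbh_def[of G v] by (auto simp: insert_commute)
    note xv = simple_graph_edge[OF sg E(1)] and vy = simple_graph_edge[OF sg E(2)]
    \<comment> \<open>The new edge follows the path through \<open>v\<close>. The point of
      \<open>v\<close> is then interior to an arc, which is allowed since \<open>v\<close> is no
      longer a vertex.\<close>
    have "graph_path G [x, v, y]" using E N xv vy by (auto simp: graph_path_def)
    from graph_path_arc[OF D this] obtain g where g: "arc g" "pathstart g = p x" "pathfinish g = p y"
        "path_image g = path_image (\<gamma> {x, v}) \<union> path_image (\<gamma> {v, y})"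
      by auto
    define \<gamma>' where "\<gamma>' = \<gamma>({x, y} := g)"
    define old where "old = {e \<in> edges G. v \<notin> e}"
    have edges: "edges (eliminate G v) = insert {x, y} old"
      using N by (auto simp: eliminate_def old_def)
    have new': "{x, y} \<notin> old" using new N by (auto simp: old_def)
    have \<gamma>'_new: "\<gamma>' {x, y} = g" by (simp add: \<gamma>'_def)
    have \<gamma>'_old: "\<gamma>' e = \<gamma> e" if "e \<in> old" for e
      using that new' by (auto simp: \<gamma>'_def)
    have meet: "path_image g \<inter> path_image (\<gamma> e) \<subseteq> p ` ({x, y} \<inter> e)" if e: "e \<in> old" for e
    proof -
      have "v \<notin> e" "e \<in> edges G" using e by (auto simp: old_def)
      then have "path_image (\<gamma> {x, v}) \<inter> path_image (\<gamma> e) \<subseteq> p ` ({x, v} \<inter> e)"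
          "path_image (\<gamma> {v, y}) \<inter> path_image (\<gamma> e) \<subseteq> p ` ({v, y} \<inter> e)"
        using cross[OF E(1) \<open>e \<in> edges G\<close>] cross[OF E(2) \<open>e \<in> edges G\<close>] by auto
      then show ?thesis using \<open>v \<notin> e\<close> g(4) by blast
    qed
    have "plane_drawing (eliminate G v) p \<gamma>'"
      unfolding plane_drawing_def edges
    proof (intro conjI ballI impI)
      show "inj_on p (verts (eliminate G v))" by (rule inj_on_subset[OF inj vH])
    next
      fix e assume e: "e \<in> insert {x, y} old"
      have "arc (\<gamma>' e) \<and> {pathstart (\<gamma>' e), pathfinish (\<gamma>' e)} = p ` e"
      proof (cases "e = {x, y}")
        case True
        then show ?thesis using g \<gamma>'_new by simp
      next
        case False
        then have "e \<in> old" using e by simp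
        then show ?thesis using arcs[of e] \<gamma>'_old[of e] by (simp add: old_def)
      qed
      then show "arc (\<gamma>' e)" and "{pathstart (\<gamma>' e), pathfinish (\<gamma>' e)} = p ` e"
        by simp_all
    next
      fix e assume e: "e \<in> insert {x, y} old"
      show "path_image (\<gamma>' e) \<inter> p ` verts (eliminate G v) \<subseteq> p ` e"
      proof (cases "e = {x, y}")
        case True
        have "path_image (\<gamma> {x, v}) \<inter> p ` verts G \<subseteq> p ` {x, v}"
            "path_image (\<gamma> {v, y}) \<inter> p ` verts G \<subseteq> p ` {v, y}"
          using avoid[OF E(1)] avoid[OF E(2)] .
        then have "path_image g \<inter> p ` verts G \<subseteq> p ` {x, v, y}" using g(4) by blast
        moreover have "p ` verts (eliminate G v) \<subseteq> p ` verts G - {p v}"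
          using inj v by (auto simp: inj_on_def eliminate_def)
        ultimately have "path_image g \<inter> p ` verts (eliminate G v) \<subseteq> p ` {x, y}" by blast
        then show ?thesis using True \<gamma>'_new by simp
      next
        case False
        then have "e \<in> old" using e by auto
        then have "path_image (\<gamma> e) \<inter> p ` verts G \<subseteq> p ` e" using avoid by (auto simp: old_def)
        then show ?thesis using \<gamma>'_old[OF \<open>e \<in> old\<close>] vH by auto
      qed
    next
      fix e f assume ef: "e \<in> insert {x, y} old" "f \<in> insert {x, y} old" "e \<noteq> f"
      then consider "e = {x, y}" "f \<in> old" | "f = {x, y}" "e \<in> old" | "e \<in> old" "f \<in> old" by auto
      then show "path_image (\<gamma>' e) \<inter> path_image (\<gamma>' f) \<subseteq> p ` (e \<inter> f)"
      proof cases
        case 1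
        then show ?thesis using meet[of f] \<gamma>'_new \<gamma>'_old by simp
      next
        case 2
        then show ?thesis using meet[of e] \<gamma>'_new \<gamma>'_old by (simp add: Int_commute)
      next
        case 3
        then have "path_image (\<gamma> e) \<inter> path_image (\<gamma> f) \<subseteq> p ` (e \<inter> f)"
          using cross ef(3) by (auto simp: old_def)
        then show ?thesis using 3 \<gamma>'_old by simp
      qed
    qed
    moreover have "drawn_set (eliminate G v) p \<gamma>' \<subseteq> drawn_set G p \<gamma>"
      using vH E g(4) \<gamma>'_new \<gamma>'_old unfolding drawn_set_def edges by (auto simp: old_def)
    ultimately show ?thesis by (rule outerplanar_subdrawing[OF outer sH _ vH])
  qed
qed

lemma outerplanar_induct [consumes 1, case_names empty eliminate]:
  assumes "outerplanar G"
    and empty: "\<And>G. outerplanar G \<Longrightarrow> verts G = {} \<Longrightarrow> P G"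
    and step: "\<And>G v. outerplanar G \<Longrightarrow> v \<in> verts G \<Longrightarrow> card (open_nbh G v) \<le> 2 \<Longrightarrow>
      P (eliminate G v) \<Longrightarrow> P G"
  shows "P G"
  using assms(1)
proof (induction "card (verts G)" arbitrary: G rule: less_induct)
  case less
  show ?case
  proof (cases "verts G = {}")
    case True
    then show ?thesis using empty less.prems by blast
  next
    case False
    then obtain v where v: "v \<in> verts G" "card (open_nbh G v) \<le> 2"
      using outerplanar_low_degree less.prems by blast
    have "card (verts (eliminate G v)) < card (verts G)"
      using v less.prems
      by (intro psubset_card_mono) (auto simp: eliminate_def outerplanar_def simple_graph_def)
    then show ?thesis
      by (intro step[OF less.prems v] less.hyps outerplanar_eliminate[OF less.prems v(1)])
  qed
qed

section \<open>Colourings with five and three colours\<close>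

definition max_once :: "('a \<Rightarrow> nat) \<Rightarrow> 'a set \<Rightarrow> bool" where
  "max_once c S \<longleftrightarrow> S = {} \<or> appears_once c S (Max (c ` S))"

lemma max_once_iff:
  assumes "finite S"
  shows "max_once c S \<longleftrightarrow> S = {} \<or> (\<exists>u\<in>S. \<forall>w\<in>S. w \<noteq> u \<longrightarrow> c w < c u)"
proof (cases "S = {}")
  case False
  have "appears_once c S (Max (c ` S)) \<longleftrightarrow> (\<exists>u\<in>S. \<forall>w\<in>S. w \<noteq> u \<longrightarrow> c w < c u)"
  proof
    assume "appears_once c S (Max (c ` S))"
    then obtain u where u: "u \<in> S" "c u = Max (c ` S)" "\<And>w. w \<in> S \<Longrightarrow> c w = Max (c ` S) \<Longrightarrow> w = u"
      by (auto simp: appears_once_def)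
    have "c w < c u" if "w \<in> S" "w \<noteq> u" for w
      using that u(2) u(3)[of w] assms Max_ge[of "c ` S" "c w"] by (simp add: le_less) metis
    then show "\<exists>u\<in>S. \<forall>w\<in>S. w \<noteq> u \<longrightarrow> c w < c u" using u(1) by blast
  next
    assume "\<exists>u\<in>S. \<forall>w\<in>S. w \<noteq> u \<longrightarrow> c w < c u"
    then obtain u where u: "u \<in> S" "\<And>w. w \<in> S \<Longrightarrow> w \<noteq> u \<Longrightarrow> c w < c u" by blast
    have "Max (c ` S) = c u"
      using u assms by (intro Max_eqI) (auto, metis le_less)
    then show "appears_once c S (Max (c ` S))"
      using u unfolding appears_once_def by (metis less_irrefl)
  qed
  then show ?thesis using False by (simp add: max_once_def)
qed (simp add: max_once_def)

text \<open>A new colour different from the current maximum either stays below it or becomes the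
  unique maximum itself.\<close>

lemma max_once_insert:
  assumes "finite S" "v \<notin> S" "max_once c S" "c v \<noteq> Max (c ` S)"
  shows "max_once c (insert v S)"
proof (cases "S = {}")
  case False
  then obtain u where u: "u \<in> S" "\<And>w. w \<in> S \<Longrightarrow> w \<noteq> u \<Longrightarrow> c w < c u"
    using assms(1,3) by (auto simp: max_once_iff)
  have "Max (c ` S) = c u"
    using u assms(1) by (intro Max_eqI) (auto, metis le_less)
  then consider "c v < c u" | "c u < c v" using assms(4) by force
  then show ?thesis
  proof cases
    case 1
    then show ?thesis using u assms(1) by (auto simp: max_once_iff)
  next
    case 2
    have "c w < c v" if "w \<in> S" for w using u(2)[OF that] 2 by (cases "w = u") auto
    then show ?thesis using assms(1) by (auto simp: max_once_iff)
  qed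
qed (simp add: max_once_iff)

lemma max_once_inj_on:
  assumes "finite S" "inj_on c S"
  shows "max_once c S"
proof (cases "S = {}")
  case False
  then have "Max (c ` S) \<in> c ` S" using assms(1) by (intro Max_in) auto
  then obtain u where "u \<in> S" "c u = Max (c ` S)" by force
  then have "c w < c u" if "w \<in> S" "w \<noteq> u" for w
    using that assms Max_ge[of "c ` S" "c w"] by (auto simp: le_less inj_on_def)
  then show ?thesis using \<open>u \<in> S\<close> assms(1) by (auto simp: max_once_iff)
qed (simp add: max_once_iff)

text \<open>For the lower bound: with four colours, a repeated 3 forces a 4, and a 4 cannot be
  repeated.\<close>

lemma max_once_repeated:
  assumes "finite S" "max_once c S" "u \<in> S" "v \<in> S" "u \<noteq> v" "c u = c v"
  shows "\<exists>w\<in>S. c u < c w"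
  using assms unfolding max_once_iff[OF assms(1)] by (metis empty_iff less_irrefl)

section \<open>Colouring along the eliminations\<close>

lemma proper_coloring_extend:
  assumes sg: "simple_graph G" and v: "v \<in> verts G"
    and c: "proper_coloring (eliminate G v) k c"
    and i: "i \<in> {1..k}" "i \<notin> c ` open_nbh G v"
  shows "proper_coloring G k (c(v := i))"
proof -
  have "(c(v := i)) u \<noteq> (c(v := i)) w" if e: "{u, w} \<in> edges G" for u w
  proof -
    have "u \<noteq> w" using simple_graph_edge(1)[OF sg e] .
    consider "u = v" "w \<in> open_nbh G v" | "w = v" "u \<in> open_nbh G v" | "{u, w} \<in> edges (eliminate G v)" "u \<noteq> v" "w \<noteq> v"
      using e by (auto simp: open_nbh_def eliminate_def insert_commute)
    then show ?thesis
      using i(2) \<open>u \<noteq> w\<close> c by cases (auto simp: proper_coloring_def)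
  qed
  then show ?thesis
    using c i(1) v by (auto simp: proper_coloring_def eliminate_def)
qed

lemma fresh_color:
  assumes "finite A" "card A < k"
  obtains i where "i \<in> {1..k}" "i \<notin> (A :: nat set)"
  using card_mono[OF assms(1), of "{1..k}"] assms(2) by fastforce

lemma outerplanar_3_colorable:
  assumes "outerplanar G"
  shows "\<exists>c. proper_coloring G 3 c"
  using assms
proof (induction rule: outerplanar_induct)
  case (empty G)
  then have "edges G = {}"
    by (auto simp: outerplanar_def simple_graph_def)
  then show ?case using empty by (auto simp: proper_coloring_def)
next
  case (eliminate G v)
  then obtain c where c: "proper_coloring (eliminate G v) 3 c" by blast
  have sg: "simple_graph G" using eliminate(1) by (simp add: outerplanar_def)
  have "card (c ` open_nbh G v) < 3"
    using card_image_le[OF finite_open_nbh[OF sg], of c v] eliminate(3) by linarith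
  then obtain i where "i \<in> {1..3}" "i \<notin> c ` open_nbh G v"
    using fresh_color[of "c ` open_nbh G v" 3] finite_open_nbh[OF sg] by blast
  then show ?case using proper_coloring_extend[OF sg eliminate(2) c] by blast
qed

text \<open>Covers both open (\<open>B = {}\<close>) and closed (\<open>B = UNIV\<close>) neighbourhoods.\<close>

definition nbh :: "'a set \<Rightarrow> 'a set set \<Rightarrow> 'a \<Rightarrow> 'a set" where
  "nbh B F v = {u. {u, v} \<in> F} \<union> ({v} \<inter> B)"

text \<open>
  The edges in \<open>F\<close> determine the neighbourhoods, while properness is required for all of \<open>G\<close>,
  which may contain edges added by eliminations. The new vertex avoids the colours of its at most
  two neighbours and the current maxima at these neighbours, at most four colours in total.
\<close>

lemma outerplanar_max_once_coloring:
  assumes "outerplanar G" "F \<subseteq> edges G"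
  shows "\<exists>c. proper_coloring G 5 c \<and> (\<forall>v\<in>verts G. max_once c (nbh B F v))"
  using assms
proof (induction arbitrary: F rule: outerplanar_induct)
  case (empty G)
  then have "edges G = {}"
    by (auto simp: outerplanar_def simple_graph_def)
  then show ?case using empty by (auto simp: proper_coloring_def)
next
  case (eliminate G v)
  have sg: "simple_graph G" using eliminate(1) by (simp add: outerplanar_def)
  define F' where "F' = {e \<in> F. v \<notin> e}"
  have "F' \<subseteq> edges (eliminate G v)"
    using eliminate.prems by (auto simp: F'_def eliminate_def)
  from eliminate.IH[OF this] obtain c where c: "proper_coloring (eliminate G v) 5 c"
      and once: "\<And>w. w \<in> verts (eliminate G v) \<Longrightarrow> max_once c (nbh B F' w)"
    by blast
  let ?N = "open_nbh G v"
  have fin: "finite ?N" using finite_open_nbh[OF sg] .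
  have finite_nbh: "finite (nbh B F w)" for w
  proof -
    have "{u. {u, w} \<in> F} \<subseteq> open_nbh G w" using eliminate.prems by (auto simp: open_nbh_def)
    then show ?thesis using finite_subset[OF _ finite_open_nbh[OF sg]] by (simp add: nbh_def)
  qed
  \<comment> \<open>If \<open>nbh B F' w\<close> is empty, its \<open>Max\<close> is an unspecified
    number. It is just one more forbidden value, so the bound of four is not affected.\<close>
  define A where "A = c ` ?N \<union> (\<lambda>w. Max (c ` nbh B F' w)) ` ?N"
  have "card A \<le> card ?N + card ?N"
    unfolding A_def using card_Un_le card_image_le[OF fin] by (meson add_mono order_trans)
  then have "card A < 5" using eliminate.hyps(3) by linarith
  then obtain i where i: "i \<in> {1..5}" "i \<notin> A"
    using fresh_color[of A 5] fin by (auto simp: A_def)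
  let ?c = "c(v := i)"
  have proper: "proper_coloring G 5 ?c"
    using i by (intro proper_coloring_extend[OF sg eliminate.hyps(2) c]) (auto simp: A_def)
  have "max_once ?c (nbh B F w)" if w: "w \<in> verts G" for w
  proof (cases "w = v")
    case True
    \<comment> \<open>Two neighbours of \<open>v\<close> are adjacent after the elimination, so
      their colours differ. With the fresh colour of \<open>v\<close>, all colours in its closed
      neighbourhood are distinct.\<close>
    have "inj_on c ?N"
    proof -
      consider "card ?N = 2" | "card ?N = 1" | "card ?N = 0" using eliminate.hyps(3) by linarith
      then show ?thesis
      proof cases
        case 1
        then obtain x y where "?N = {x, y}" "x \<noteq> y" by (auto simp: card_2_iff)
        moreover from this 1 have "{x, y} \<in> edges (eliminate G v)" by (auto simp: eliminate_def)
        ultimately show ?thesis using c by (auto simp: proper_coloring_def)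
      qed (use fin in \<open>auto simp: card_1_singleton_iff\<close>)
    qed
    moreover have "v \<notin> ?N" using open_nbh_subset[OF sg, of v] by auto
    ultimately have "inj_on ?c (insert v ?N)"
      using i(2) by (auto simp: A_def inj_on_def)
    moreover have "nbh B F v \<subseteq> insert v ?N"
      using eliminate.prems by (auto simp: nbh_def open_nbh_def)
    ultimately have "inj_on ?c (nbh B F v)" by (rule inj_on_subset)
    then show ?thesis using True max_once_inj_on[OF finite_nbh] by blast
  next
    case False
    have v_notin: "v \<notin> nbh B F' w" using False by (auto simp: nbh_def F'_def)
    have nbh_eq: "nbh B F w = nbh B F' w \<union> (if {v, w} \<in> F then {v} else {})"
      using False by (auto simp: nbh_def F'_def)
    have finF': "finite (nbh B F' w)" using finite_nbh[of w] nbh_eq by simp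
    have c_eq: "?c ` nbh B F' w = c ` nbh B F' w" using v_notin by (intro image_cong) auto
    have "max_once c (nbh B F' w)" using once[of w] w False by (simp add: eliminate_def)
    then have once': "max_once ?c (nbh B F' w)"
      using v_notin by (auto simp: max_once_iff[OF finF'])
    show ?thesis
    proof (cases "{v, w} \<in> F")
      case True
      then have "w \<in> ?N" using eliminate.prems by (auto simp: open_nbh_def insert_commute)
      then have "i \<noteq> Max (c ` nbh B F' w)" using i(2) by (auto simp: A_def)
      then have "?c v \<noteq> Max (?c ` nbh B F' w)" unfolding c_eq by simp
      then show ?thesis
        using max_once_insert[OF finF' v_notin once'] nbh_eq True by simp
    qed (use once' nbh_eq in simp)
  qed
  then show ?case using proper by blast
qed

section \<open>From the general colourings to the four variants\<close>

lemma outerplanar_pUMo: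
  assumes "outerplanar G" "no_isolated G"
  shows "\<exists>c. pUMo_coloring G 5 c"
proof -
  obtain c where c: "proper_coloring G 5 c" "\<forall>v\<in>verts G. max_once c (nbh {} (edges G) v)"
    using outerplanar_max_once_coloring[OF assms(1) order_refl] by blast
  have "nbh {} (edges G) v = open_nbh G v" for v by (simp add: nbh_def open_nbh_def)
  then show ?thesis
    using c assms(2) by (auto simp: pUMo_coloring_def max_once_def no_isolated_def)
qed

lemma outerplanar_pUMc:
  assumes "outerplanar G"
  shows "\<exists>c. pUMc_coloring G 5 c"
proof -
  obtain c where c: "proper_coloring G 5 c" "\<forall>v\<in>verts G. max_once c (nbh UNIV (edges G) v)"
    using outerplanar_max_once_coloring[OF assms(1) order_refl] by blast
  have "nbh UNIV (edges G) v = closed_nbh G v" for v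
    by (auto simp: nbh_def open_nbh_def closed_nbh_def)
  then show ?thesis
    using c by (auto simp: pUMc_coloring_def max_once_def closed_nbh_def)
qed

lemma pUMo_imp_pCFo: "pUMo_coloring G k c \<Longrightarrow> pCFo_coloring G k c"
  by (auto simp: pUMo_coloring_def pCFo_coloring_def)

lemma pCFc_iff_proper:
  assumes "simple_graph G"
  shows "pCFc_coloring G k c \<longleftrightarrow> proper_coloring G k c"
proof
  assume c: "proper_coloring G k c"
  have "appears_once c (closed_nbh G v) (c v)" for v
    using c by (auto simp: appears_once_def closed_nbh_def open_nbh_def proper_coloring_def)
  then show "pCFc_coloring G k c" using c by (auto simp: pCFc_coloring_def)
qed (simp add: pCFc_coloring_def)

section \<open>Graphs drawn on a parabola\<close>

text \<open>On a strictly convex curve, chords lie on or above the curve, they cross only if their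
  ends interleave, and every point is accessible from below, that is, from the outer face.\<close>

definition parabola_point :: "nat \<Rightarrow> complex" where
  "parabola_point i = Complex (real i) ((real i)\<^sup>2)"

lemma parabola_point_eq_iff [simp]: "parabola_point i = parabola_point j \<longleftrightarrow> i = j"
  by (simp add: parabola_point_def)

lemma parabola_chordD:
  assumes "z \<in> closed_segment (parabola_point i) (parabola_point j)" "i < j"
  shows "real i \<le> Re z" "Re z \<le> real j" "Im z = (real i + real j) * Re z - real i * real j"
proof -
  obtain u where u: "0 \<le> u" "u \<le> 1" "z = (1 - u) *\<^sub>R parabola_point i + u *\<^sub>R parabola_point j"
    using assms(1) by (auto simp: closed_segment_def)
  have re: "Re z = real i + u * (real j - real i)"
    using arg_cong[OF u(3), of Re] by (simp add: parabola_point_def algebra_simps)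
  show "real i \<le> Re z" using re u(1) assms(2) by simp
  have "u * (real j - real i) \<le> real j - real i"
    using u assms(2) by (intro mult_left_le_one_le) auto
  then show "Re z \<le> real j" using re by linarith
  show "Im z = (real i + real j) * Re z - real i * real j"
    unfolding re using arg_cong[OF u(3), of Im] by (simp add: parabola_point_def algebra_simps power2_eq_square)
qed

lemma parabola_chord_above:
  assumes "z \<in> closed_segment (parabola_point i) (parabola_point j)" "i < j"
  shows "Im z - (Re z)\<^sup>2 = (Re z - real i) * (real j - Re z)" "(Re z)\<^sup>2 \<le> Im z"
proof -
  note z = parabola_chordD[OF assms]
  show eq: "Im z - (Re z)\<^sup>2 = (Re z - real i) * (real j - Re z)"
    using z(3) by (simp add: algebra_simps power2_eq_square)
  have "0 \<le> (Re z - real i) * (real j - Re z)" using z(1,2) by (intro mult_nonneg_nonneg) auto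
  then show "(Re z)\<^sup>2 \<le> Im z" using eq by linarith
qed

lemma parabola_chord_at_end:
  assumes "z \<in> closed_segment (parabola_point i) (parabola_point j)" "i < j"
    and "Re z = real m" "m \<in> {i, j}"
  shows "z = parabola_point m"
  using parabola_chord_above(1)[OF assms(1,2)] assms(3,4)
  by (auto simp: complex_eq_iff parabola_point_def)

text \<open>At a common point both chords have the same height above the parabola. Extending the
  interval from \<open>k\<close>, \<open>l\<close> to \<open>i\<close>, \<open>j\<close> one end at
  a time can only increase the product giving this height, so both extensions leave it unchanged,
  which forces a common end.\<close>

lemma parabola_nested_chords:
  assumes z: "z \<in> closed_segment (parabola_point i) (parabola_point j)"
      "z \<in> closed_segment (parabola_point k) (parabola_point l)"
    and "i \<le> k" "k < l" "l \<le> j" "(i, j) \<noteq> (k, l)"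
  shows "z \<in> parabola_point ` ({i, j} \<inter> {k, l})"
proof -
  have ij: "i < j" using assms by auto
  let ?x = "Re z"
  have b: "real k \<le> ?x" "?x \<le> real l" using parabola_chordD[OF z(2) \<open>k < l\<close>] by auto
  have eq: "(?x - real i) * (real j - ?x) = (?x - real k) * (real l - ?x)"
    using parabola_chord_above(1)[OF z(1) ij] parabola_chord_above(1)[OF z(2) \<open>k < l\<close>] by simp
  have le: "(?x - real k) * (real l - ?x) \<le> (?x - real k) * (real j - ?x)"
      "(?x - real k) * (real j - ?x) \<le> (?x - real i) * (real j - ?x)"
    using b assms(3,5) by (auto intro!: mult_left_mono mult_right_mono)
  have "(?x - real k) * (real l - real j) = 0" "(real k - real i) * (real j - ?x) = 0"
    using eq le by (simp_all add: algebra_simps)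
  then have "(?x = real k \<or> l = j) \<and> (k = i \<or> ?x = real j)" by auto
  then consider "?x = real k" "k = i" | "?x = real j" "l = j"
    using assms(3-6) b by fastforce
  then show ?thesis
  proof cases
    case 1
    then show ?thesis using parabola_chord_at_end[OF z(1) ij, of i] by auto
  next
    case 2
    then show ?thesis using parabola_chord_at_end[OF z(1) ij, of j] by auto
  qed
qed

text \<open>Without interleaving, the chords lie over nested intervals or over intervals with at
  most an end in common; in the latter case the abscissa of \<open>z\<close> is forced.\<close>

lemma parabola_chords_meet:
  assumes z: "z \<in> closed_segment (parabola_point i) (parabola_point j)"
      "z \<in> closed_segment (parabola_point k) (parabola_point l)"
    and "i < j" "k < l" "(i, j) \<noteq> (k, l)"
    and "\<not> (i < k \<and> k < j \<and> j < l)" "\<not> (k < i \<and> i < l \<and> l < j)"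
  shows "z \<in> parabola_point ` ({i, j} \<inter> {k, l})"
proof -
  note b = parabola_chordD[OF z(1) \<open>i < j\<close>] parabola_chordD[OF z(2) \<open>k < l\<close>]
  consider "j \<le> k" | "l \<le> i" | "i \<le> k" "l \<le> j" | "k \<le> i" "j \<le> l" using assms(6,7) by linarith
  then show ?thesis
  proof cases
    case 1
    then have "Re z = real j" "j = k" using b by linarith+
    then show ?thesis using parabola_chord_at_end[OF z(1) \<open>i < j\<close>, of j] by auto
  next
    case 2
    then have "Re z = real i" "i = l" using b by linarith+
    then show ?thesis using parabola_chord_at_end[OF z(1) \<open>i < j\<close>, of i] by auto
  next
    case 3
    then show ?thesis using parabola_nested_chords[OF z] assms by blast
  next
    case 4
    then show ?thesis using parabola_nested_chords[OF z(2,1)] assms by blast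
  qed
qed

text \<open>The open vertical ray below the point is connected, unbounded and disjoint from
  \<open>S\<close>, so it lies in the outside; the point is in its closure.\<close>

lemma above_parabola_outer:
  assumes S: "\<And>z. z \<in> S \<Longrightarrow> (Re z)\<^sup>2 \<le> Im z" and P: "parabola_point i \<in> S"
  shows "parabola_point i \<in> frontier (outside S)"
proof -
  define R where "R = {z. Re z = real i \<and> Im z < (real i)\<^sup>2}"
  have "convex R"
  proof -
    have "R = {z. Re z = real i} \<inter> {z. Im z < (real i)\<^sup>2}" by (auto simp: R_def)
    then show ?thesis
      using convex_hyperplane[of "1::complex" "real i"] convex_halfspace_Im_lt[of "(real i)\<^sup>2"]
      by (auto intro!: convex_Int simp: inner_complex_def)
  qed
  have "\<not> bounded R"
  proof
    assume "bounded R"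
    then obtain B where B: "\<And>z. z \<in> R \<Longrightarrow> norm z \<le> B" by (auto simp: bounded_iff)
    let ?z = "Complex (real i) (- \<bar>B\<bar> - 1)"
    have "- \<bar>B\<bar> - 1 < (real i)\<^sup>2" by (rule less_le_trans[of _ 0]) auto
    then have "norm ?z \<le> B" by (intro B) (simp add: R_def)
    moreover have "\<bar>Im ?z\<bar> \<le> norm ?z" by (rule abs_Im_le_cmod)
    ultimately show False by simp
  qed
  have "R \<inter> S = {}" using S by (force simp: R_def)
  have "R \<subseteq> outside S"
  proof
    fix z assume z: "z \<in> R"
    then have "R \<subseteq> connected_component_set (- S) z"
      using \<open>R \<inter> S = {}\<close> convex_connected[OF \<open>convex R\<close>]
      by (intro connected_component_maximal) auto
    then show "z \<in> outside S"
      using \<open>\<not> bounded R\<close> bounded_subset by (auto simp: outside)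
  qed
  moreover have "parabola_point i \<in> closure R"
  proof (unfold closure_approachable, intro allI impI)
    fix e :: real assume e: "0 < e"
    let ?z = "Complex (real i) ((real i)\<^sup>2 - e / 2)"
    have "dist ?z (parabola_point i) < e"
      using e by (simp add: dist_norm parabola_point_def cmod_def)
    then show "\<exists>z\<in>R. dist z (parabola_point i) < e" using e by (intro bexI[of _ ?z]) (auto simp: R_def)
  qed
  ultimately have "parabola_point i \<in> closure (outside S)" using closure_mono by blast
  moreover have "parabola_point i \<notin> interior (outside S)"
    using P interior_subset outside_no_overlap[of S] by blast
  ultimately show ?thesis by (simp add: frontier_def)
qed

text \<open>The map \<open>f\<close> carries the examples into an arbitrary infinite vertex type,
  while the numbers serve as abscissas on the parabola.\<close>

definition chord_graph :: "(nat \<Rightarrow> 'a) \<Rightarrow> nat \<Rightarrow> (nat \<times> nat) set \<Rightarrow> 'a graph" where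
  "chord_graph f n E = \<lparr>verts = f ` {..<n}, edges = (\<lambda>(i, j). {f i, f j}) ` E\<rparr>"

lemma outerplanar_chord_graph:
  assumes f: "inj f" and E: "\<And>i j. (i, j) \<in> E \<Longrightarrow> i < j \<and> j < n"
    and cross: "\<And>i j k l. (i, j) \<in> E \<Longrightarrow> (k, l) \<in> E \<Longrightarrow> \<not> (i < k \<and> k < j \<and> j < l)"
  shows "outerplanar (chord_graph f n E)"
proof -
  let ?G = "chord_graph f n E"
  define p where "p v = parabola_point (inv f v)" for v
  \<comment> \<open>\<open>Min\<close> and \<open>Max\<close> recover the increasing pair from the
    unordered edge and so orient the chord.\<close>
  define \<gamma> where "\<gamma> e = linepath (parabola_point (Min (inv f ` e))) (parabola_point (Max (inv f ` e)))" for e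
  have p [simp]: "p (f i) = parabola_point i" for i using f by (simp add: p_def)
  have \<gamma>: "\<gamma> {f i, f j} = linepath (parabola_point i) (parabola_point j)" if "(i, j) \<in> E" for i j
    using f E[OF that] by (simp add: \<gamma>_def)
  have e: "\<exists>i j. (i, j) \<in> E \<and> e = {f i, f j}" if "e \<in> edges ?G" for e
    using that by (auto simp: chord_graph_def)
  have verts_chord: "v \<in> range f" if "v \<in> verts ?G" for v
    using that by (auto simp: chord_graph_def)
  have sg: "simple_graph ?G"
    using E f by (fastforce simp: simple_graph_def chord_graph_def card_2_iff inj_eq)
  have draw: "plane_drawing ?G p \<gamma>"
    unfolding plane_drawing_def
  proof (intro conjI ballI impI)
    show "inj_on p (verts ?G)"
      by (auto simp: chord_graph_def intro!: inj_onI)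
  next
    fix e assume "e \<in> edges ?G"
    then obtain i j where ij: "(i, j) \<in> E" "e = {f i, f j}" using e by blast
    show "arc (\<gamma> e)" "{pathstart (\<gamma> e), pathfinish (\<gamma> e)} = p ` e"
      using \<gamma>[OF ij(1)] E[OF ij(1)] ij(2) by (auto simp: arc_linepath)
    have "\<forall>m. parabola_point m \<in> closed_segment (parabola_point i) (parabola_point j) \<longrightarrow> m = i \<or> m = j"
      using parabola_chord_above(1)[of "parabola_point _" i j] E[OF ij(1)]
      by (force simp: parabola_point_def)
    then show "path_image (\<gamma> e) \<inter> p ` verts ?G \<subseteq> p ` e"
      using \<gamma>[OF ij(1)] ij(2) by (auto simp: chord_graph_def)
  next
    fix e e' assume "e \<in> edges ?G" "e' \<in> edges ?G" and ne: "e \<noteq> e'"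
    then obtain i j k l where ij: "(i, j) \<in> E" "e = {f i, f j}" and kl: "(k, l) \<in> E" "e' = {f k, f l}"
      using e by meson
    have "e \<inter> e' = f ` ({i, j} \<inter> {k, l})" using f ij kl by (auto simp: inj_eq)
    then have "p ` (e \<inter> e') = parabola_point ` ({i, j} \<inter> {k, l})" by (simp add: image_image)
    moreover have "(i, j) \<noteq> (k, l)" using ne ij kl by auto
    ultimately show "path_image (\<gamma> e) \<inter> path_image (\<gamma> e') \<subseteq> p ` (e \<inter> e')"
      using parabola_chords_meet[of _ i j k l] E[OF ij(1)] E[OF kl(1)] cross[OF ij(1) kl(1)]
        cross[OF kl(1) ij(1)] \<gamma>[OF ij(1)] \<gamma>[OF kl(1)] ij(2) kl(2) by auto
  qed
  have "(Re z)\<^sup>2 \<le> Im z" if "z \<in> drawn_set ?G p \<gamma>" for z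
    using that unfolding drawn_set_def
  proof
    assume "z \<in> p ` verts ?G"
    then show ?thesis by (auto simp: chord_graph_def parabola_point_def)
  next
    assume "z \<in> (\<Union>e\<in>edges ?G. path_image (\<gamma> e))"
    then obtain i j where "(i, j) \<in> E" "z \<in> path_image (\<gamma> {f i, f j})" using e by blast
    then show ?thesis using parabola_chord_above(2)[of z i j] \<gamma> E by auto
  qed
  then have "p ` verts ?G \<subseteq> frontier (outside (drawn_set ?G p \<gamma>))"
    using above_parabola_outer[of "drawn_set ?G p \<gamma>"]
    by (smt (verit) UnCI drawn_set_def image_iff p subsetI verts_chord)
  then show ?thesis using sg draw by (auto simp: outerplanar_def)
qed

lemma edge_chord_graph:
  assumes "inj f"
  shows "{f i, f j} \<in> edges (chord_graph f n E) \<longleftrightarrow> (i, j) \<in> E \<or> (j, i) \<in> E"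
  using assms by (force simp: chord_graph_def doubleton_eq_iff inj_eq)

lemma open_nbh_chord_graph:
  assumes "inj f"
  shows "open_nbh (chord_graph f n E) (f i) = f ` {j. (i, j) \<in> E \<or> (j, i) \<in> E}"
proof
  show "f ` {j. (i, j) \<in> E \<or> (j, i) \<in> E} \<subseteq> open_nbh (chord_graph f n E) (f i)"
    using edge_chord_graph[OF assms, of _ i n E] by (auto simp: open_nbh_def)
  show "open_nbh (chord_graph f n E) (f i) \<subseteq> f ` {j. (i, j) \<in> E \<or> (j, i) \<in> E}"
    using assms by (force simp: open_nbh_def chord_graph_def doubleton_eq_iff inj_eq)
qed

section \<open>The triangle and the pentagon\<close>

definition triangle_chords :: "(nat \<times> nat) set" where
  "triangle_chords = {(0, 1), (1, 2), (0, 2)}"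

definition pentagon_chords :: "(nat \<times> nat) set" where
  "pentagon_chords = {(0, 1), (1, 2), (2, 3), (3, 4), (0, 4)}"

lemma outerplanar_triangle: "inj f \<Longrightarrow> outerplanar (chord_graph f 3 triangle_chords)"
  by (rule outerplanar_chord_graph) (auto simp: triangle_chords_def)

lemma outerplanar_pentagon: "inj f \<Longrightarrow> outerplanar (chord_graph f 5 pentagon_chords)"
  by (rule outerplanar_chord_graph) (auto simp: pentagon_chords_def)

lemma proper_coloringD:
  assumes "proper_coloring (chord_graph f n E) k c"
  shows "(i, j) \<in> E \<Longrightarrow> c (f i) \<noteq> c (f j)" and "i < n \<Longrightarrow> c (f i) \<in> {1..k}"
proof -
  assume "(i, j) \<in> E"
  then have "{f i, f j} \<in> edges (chord_graph f n E)" by (force simp: chord_graph_def)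
  then show "c (f i) \<noteq> c (f j)" using assms by (auto simp: proper_coloring_def)
next
  assume "i < n"
  then have "f i \<in> verts (chord_graph f n E)" by (simp add: chord_graph_def)
  then show "c (f i) \<in> {1..k}" using assms unfolding proper_coloring_def by blast
qed

lemma triangle_proper_coloring_ge_3:
  assumes "proper_coloring (chord_graph f 3 triangle_chords) k c"
  shows "3 \<le> k"
proof -
  have "c (f 0) \<noteq> c (f 1)" "c (f 1) \<noteq> c (f 2)" "c (f 0) \<noteq> c (f 2)"
    by (rule proper_coloringD(1)[OF assms]; simp add: triangle_chords_def)+
  moreover have "c (f 0) \<in> {1..k}" "c (f 1) \<in> {1..k}" "c (f 2) \<in> {1..k}"
    by (rule proper_coloringD(2)[OF assms]; simp)+
  ultimately show ?thesis by simp
qed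

lemma pentagon_open_nbh:
  assumes "inj f"
  defines "G \<equiv> chord_graph f 5 pentagon_chords"
  shows "open_nbh G (f 0) = {f 1, f 4}" "open_nbh G (f 1) = {f 0, f 2}" "open_nbh G (f 2) = {f 1, f 3}"
    "open_nbh G (f 3) = {f 2, f 4}" "open_nbh G (f 4) = {f 0, f 3}"
  unfolding G_def open_nbh_chord_graph[OF assms(1)] by (auto simp: pentagon_chords_def)

lemma no_isolated_pentagon:
  assumes "inj f"
  shows "no_isolated (chord_graph f 5 pentagon_chords)"
proof -
  have "{..<5::nat} = {0, 1, 2, 3, 4}" by auto
  then have "verts (chord_graph f 5 pentagon_chords) = {f 0, f 1, f 2, f 3, f 4}"
    by (simp add: chord_graph_def)
  then show ?thesis
    using pentagon_open_nbh[OF assms] by (simp add: no_isolated_def)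
qed

lemma appears_once_pair:
  assumes "appears_once c {u, v} i" "u \<noteq> v"
  shows "c u \<noteq> c v"
  using assms unfolding appears_once_def by (metis insertCI empty_iff insert_iff)

text \<open>The two neighbours of each vertex must have different colours. Any two vertices of the
  pentagon are adjacent or have a common neighbour, so all five colours differ.\<close>

lemma pentagon_pCFo_coloring_ge_5:
  assumes f: "inj f" and c: "pCFo_coloring (chord_graph f 5 pentagon_chords) k c"
  shows "5 \<le> k"
proof -
  let ?G = "chord_graph f 5 pentagon_chords"
  have p: "proper_coloring ?G k c" using c by (simp add: pCFo_coloring_def)
  have adj: "c (f 0) \<noteq> c (f 1)" "c (f 1) \<noteq> c (f 2)" "c (f 2) \<noteq> c (f 3)" "c (f 3) \<noteq> c (f 4)" "c (f 0) \<noteq> c (f 4)"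
    by (rule proper_coloringD(1)[OF p]; simp add: pentagon_chords_def)+
  have once: "\<exists>i. appears_once c (open_nbh ?G (f m)) i" if "m < 5" for m
    using c that by (auto simp: pCFo_coloring_def chord_graph_def)
  have dist2: "c (f 1) \<noteq> c (f 4)" "c (f 0) \<noteq> c (f 2)" "c (f 1) \<noteq> c (f 3)" "c (f 2) \<noteq> c (f 4)" "c (f 0) \<noteq> c (f 3)"
    subgoal using once[of 0] appears_once_pair[of c "f 1" "f 4"] f
      unfolding pentagon_open_nbh[OF f] by (auto simp: inj_eq)
    subgoal using once[of 1] appears_once_pair[of c "f 0" "f 2"] f
      unfolding pentagon_open_nbh[OF f] by (auto simp: inj_eq)
    subgoal using once[of 2] appears_once_pair[of c "f 1" "f 3"] f
      unfolding pentagon_open_nbh[OF f] by (auto simp: inj_eq)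
    subgoal using once[of 3] appears_once_pair[of c "f 2" "f 4"] f
      unfolding pentagon_open_nbh[OF f] by (auto simp: inj_eq)
    subgoal using once[of 4] appears_once_pair[of c "f 0" "f 3"] f
      unfolding pentagon_open_nbh[OF f] by (auto simp: inj_eq)
    done
  let ?S = "{c (f 0), c (f 1), c (f 2), c (f 3), c (f 4)}"
  have "?S \<subseteq> {1..k}" using proper_coloringD(2)[OF p] by simp
  then have "card ?S \<le> k" using card_mono[of "{1..k}" ?S] by simp
  moreover have "card ?S = 5" using adj dist2 by (simp add: card_insert_if)
  ultimately show ?thesis by simp
qed

section \<open>The triangle with two fans at each corner\<close>

text \<open>
  Each corner \<open>9 * m\<close> of a triangle is joined to two disjoint paths with four vertices. If such a
  corner has colour at most 2, then a fan without colour 4 would use the two remaining colours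
  alternately, so that 3 appears twice around an inner path vertex. So both fans of that corner
  contain the colour 4. Hence every corner has colour 3 or 4.
\<close>

definition fan_triangle_chords :: "(nat \<times> nat) set" where
  "fan_triangle_chords =
     {(9 * m, 9 * m + i) | m i. m < 3 \<and> 1 \<le> i \<and> i \<le> 8} \<union>
     {(9 * m + i, 9 * m + Suc i) | m i. m < 3 \<and> i \<in> {1, 2, 3, 5, 6, 7}} \<union>
     {(0, 9), (9, 18), (0, 18)}"

text \<open>Corners are the multiples of 9. The cases are the fan edges, the path edges and the
  edges of the triangle, reduced to what the arguments about crossings and neighbourhoods
  use.\<close>

lemma fan_triangle_chords_cases:
  assumes "(u, v) \<in> fan_triangle_chords"
  obtains "9 dvd u" "u < v" "v < u + 9" | "v = Suc u" | "9 dvd u" "9 dvd v"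
  using assms by (auto simp: fan_triangle_chords_def)

text \<open>A chord with a vertex strictly between its ends starts at a corner, so interleaving
  chords both do. Each then leaves the block of its first corner and so also ends at a corner, which
  gives four different corners below 27.\<close>

lemma outerplanar_fan_triangle:
  assumes "inj f"
  shows "outerplanar (chord_graph f 27 fan_triangle_chords)"
proof (rule outerplanar_chord_graph[OF assms])
  show bound: "i < j \<and> j < 27" if "(i, j) \<in> fan_triangle_chords" for i j
    using that by (auto simp: fan_triangle_chords_def)
  show "\<not> (i < k \<and> k < j \<and> j < l)"
    if ij: "(i, j) \<in> fan_triangle_chords" and kl: "(k, l) \<in> fan_triangle_chords" for i j k l
  proof
    assume cross: "i < k \<and> k < j \<and> j < l"
    have "9 dvd i" "9 dvd k"
      using fan_triangle_chords_cases[OF ij] fan_triangle_chords_cases[OF kl] cross by auto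
    then obtain a b where ab: "i = 9 * a" "k = 9 * b" by (auto elim!: dvdE)
    then have "a < b" using cross by simp
    then have "\<not> j < i + 9" using ab cross by linarith
    then obtain c where c: "j = 9 * c"
      using fan_triangle_chords_cases[OF ij] cross by (auto elim!: dvdE)
    then have "b < c" using ab cross by simp
    then have "\<not> l < k + 9" using ab c cross by linarith
    then obtain d where "l = 9 * d"
      using fan_triangle_chords_cases[OF kl] cross by (auto elim!: dvdE)
    then show False using \<open>a < b\<close> \<open>b < c\<close> c cross bound[OF kl] by simp
  qed
qed

text \<open>Offsets 2, 3, 6 and 7 are the inner vertices of the two paths; to find a larger colour
  there, the neighbourhood must be known exactly. At a corner, it suffices that both fans belong to
  it.\<close>

lemma fan_triangle_closed_nbh:
  assumes f: "inj f" and "m < 3"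
  defines "G \<equiv> chord_graph f 27 fan_triangle_chords"
  shows "i \<in> {2, 3, 6, 7} \<Longrightarrow>
      closed_nbh G (f (9 * m + i)) = {f (9 * m), f (9 * m + i - 1), f (9 * m + i), f (9 * m + i + 1)}"
    and "1 \<le> i \<Longrightarrow> i \<le> 8 \<Longrightarrow> f (9 * m + i) \<in> closed_nbh G (f (9 * m))"
proof -
  assume i: "i \<in> {2, 3, 6, 7}"
  have "{j. (9 * m + i, j) \<in> fan_triangle_chords \<or> (j, 9 * m + i) \<in> fan_triangle_chords}
      = {9 * m, 9 * m + i - 1, 9 * m + i + 1}" (is "?N = _")
  proof (intro subset_antisym subsetI)
    fix j assume "j \<in> ?N"
    moreover have ndvd: "\<not> 9 dvd 9 * m + i" using i by (auto simp: dvd_add_right_iff)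
    moreover have "j = 9 * m" if j: "9 dvd j" "j < 9 * m + i" "9 * m + i < j + 9"
    proof -
      obtain q where "j = 9 * q" using j(1) by (elim dvdE)
      then have "q \<le> m" "m \<le> q" using j(2,3) i by auto
      then show ?thesis using \<open>j = 9 * q\<close> by simp
    qed
    ultimately show "j \<in> {9 * m, 9 * m + i - 1, 9 * m + i + 1}"
      by (auto elim!: fan_triangle_chords_cases)
  next
    fix j assume j: "j \<in> {9 * m, 9 * m + i - 1, 9 * m + i + 1}"
    have "(9 * m, 9 * m + i) \<in> fan_triangle_chords"
      using i \<open>m < 3\<close> by (auto simp: fan_triangle_chords_def)
    moreover have "(9 * m + i, 9 * m + i + 1) \<in> fan_triangle_chords"
      using i \<open>m < 3\<close> by (auto simp: fan_triangle_chords_def)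
    moreover have "(9 * m + i - 1, 9 * m + i) \<in> fan_triangle_chords"
    proof -
      have "i - 1 \<in> {1, 2, 3, 5, 6, 7}" using i by auto
      then have "(9 * m + (i - 1), 9 * m + Suc (i - 1)) \<in> fan_triangle_chords"
        unfolding fan_triangle_chords_def using \<open>i - 1 \<in> {1, 2, 3, 5, 6, 7}\<close> \<open>m < 3\<close> by blast
      moreover have "9 * m + (i - 1) = 9 * m + i - 1" "9 * m + Suc (i - 1) = 9 * m + i" using i by auto
      ultimately show ?thesis by (simp only:)
    qed
    ultimately show "j \<in> ?N" using j by auto
  qed
  then show "closed_nbh G (f (9 * m + i)) = {f (9 * m), f (9 * m + i - 1), f (9 * m + i), f (9 * m + i + 1)}"
    unfolding closed_nbh_def G_def open_nbh_chord_graph[OF f] by auto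
next
  assume "1 \<le> i" "i \<le> 8"
  then have "(9 * m, 9 * m + i) \<in> fan_triangle_chords"
    using \<open>m < 3\<close> by (auto simp: fan_triangle_chords_def)
  then show "f (9 * m + i) \<in> closed_nbh G (f (9 * m))"
    unfolding closed_nbh_def G_def open_nbh_chord_graph[OF f] by auto
qed

lemma fan_triangle_pUMc_coloring_ge_5:
  assumes f: "inj f" and c: "pUMc_coloring (chord_graph f 27 fan_triangle_chords) k c"
  shows "5 \<le> k"
proof (rule ccontr)
  assume "\<not> 5 \<le> k"
  let ?G = "chord_graph f 27 fan_triangle_chords"
  have p: "proper_coloring ?G k c" using c by (simp add: pUMc_coloring_def)
  define x where "x i = c (f i)" for i
  have range: "1 \<le> x i" "x i \<le> 4" if "i < 27" for i
    using proper_coloringD(2)[OF p that] \<open>\<not> 5 \<le> k\<close> by (auto simp: x_def)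
  have sg: "simple_graph ?G" using outerplanar_fan_triangle[OF f] by (simp add: outerplanar_def)
  have once: "max_once c (closed_nbh ?G (f i))" if "i < 27" for i
    using c that by (auto simp: pUMc_coloring_def chord_graph_def max_once_def)
  have fin: "finite (closed_nbh ?G v)" for v
    using finite_open_nbh[OF sg] by (simp add: closed_nbh_def)
  have corner: "3 \<le> x (9 * m)" if m: "m < 3" for m
  proof (rule ccontr)
    assume low: "\<not> 3 \<le> x (9 * m)"
    define h where "h i = x (9 * m + i)" for i
    have adj0: "x (9 * m) \<noteq> h i" if "1 \<le> i" "i \<le> 8" for i
      unfolding h_def x_def using that m
      by (intro proper_coloringD(1)[OF p]) (auto simp: fan_triangle_chords_def)
    have adj: "h i \<noteq> h (Suc i)" if "i \<in> {1, 2, 3, 5, 6, 7}" for i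
      unfolding h_def x_def using that m
      by (intro proper_coloringD(1)[OF p]) (unfold fan_triangle_chords_def, blast)
    \<comment> \<open>A repeated 3 demands a 4 nearby. The corner has colour at most 2, so only the
      inner vertex itself can supply it.\<close>
    have inner: "h (i - 1) \<noteq> 3 \<or> h (i + 1) \<noteq> 3 \<or> h i = 4"
      if i: "i \<in> {2, 3, 6, 7}" for i
    proof (rule ccontr)
      assume "\<not> ?thesis"
      moreover have "9 * m + (i - 1) = 9 * m + i - 1" using i by auto
      ultimately have 3: "x (9 * m + i - 1) = 3" "x (9 * m + i + 1) = 3" "x (9 * m + i) \<noteq> 4"
        by (auto simp: h_def)
      let ?S = "closed_nbh ?G (f (9 * m + i))"
      note S = fan_triangle_closed_nbh(1)[OF f m i]
      have i27: "9 * m + i < 27" using i m by auto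
      have "f (9 * m + i - 1) \<noteq> f (9 * m + i + 1)"
        using f by (simp add: inj_eq)
      then obtain w where "w \<in> ?S" "3 < c w"
        using max_once_repeated[OF fin once[OF i27], of "f (9 * m + i - 1)" "f (9 * m + i + 1)"] 3 S
        unfolding x_def by auto
      then show False using S 3 low range[OF i27] by (auto simp: x_def)
    qed
    \<comment> \<open>The two fans have offsets \<open>s + 1\<close> to \<open>s + 4\<close> with
      \<open>s\<close> being 0 or 4. Without colour 4, only 3 and one further colour remain, so 3 is
      at both ends of some three consecutive vertices, against \<open>inner\<close>.\<close>
    have fan: "\<exists>i\<in>{s + 1..s + 4}. h i = 4" if s: "s \<in> {0, 4}" for s
    proof (rule ccontr)
      assume no4: "\<not> ?thesis"
      have y: "1 \<le> h i \<and> h i \<le> 3 \<and> h i \<noteq> x (9 * m)"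
        if "i \<in> {s + 1..s + 4}" for i
      proof -
        have i: "1 \<le> i" "i \<le> 8" using that s by auto
        then have "9 * m + i < 27" using m by simp
        moreover have "h i \<noteq> 4" using no4 that by blast
        ultimately show ?thesis using range[of "9 * m + i"] adj0[OF i] by (simp add: h_def)
      qed
      have a: "h (s + 1) \<noteq> h (s + 2)" "h (s + 2) \<noteq> h (s + 3)"
          "h (s + 3) \<noteq> h (s + 4)"
        using adj[of "s + 1"] adj[of "s + 2"] adj[of "s + 3"] s by (auto simp: numeral_eq_Suc)
      have b: "h (s + 1) \<noteq> 3 \<or> h (s + 3) \<noteq> 3"
          "h (s + 2) \<noteq> 3 \<or> h (s + 4) \<noteq> 3"
        using inner[of "s + 2"] inner[of "s + 3"] s no4 by (auto simp: numeral_eq_Suc)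
      have "x (9 * m) = 1 \<or> x (9 * m) = 2" using low range[of "9 * m"] m by linarith
      moreover have
        "1 \<le> h (s + 1) \<and> h (s + 1) \<le> 3 \<and> h (s + 1) \<noteq> x (9 * m)"
        "1 \<le> h (s + 2) \<and> h (s + 2) \<le> 3 \<and> h (s + 2) \<noteq> x (9 * m)"
        "1 \<le> h (s + 3) \<and> h (s + 3) \<le> 3 \<and> h (s + 3) \<noteq> x (9 * m)"
        "1 \<le> h (s + 4) \<and> h (s + 4) \<le> 3 \<and> h (s + 4) \<noteq> x (9 * m)"
        by (rule y; simp)+
      ultimately show False using a b by presburger
    qed
    \<comment> \<open>The colour 4 occurs in both fans, hence twice around the corner, which would
      demand a colour above 4.\<close>
    obtain i j where ij: "i \<in> {1..4}" "h i = 4" "j \<in> {5..8}" "h j = 4"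
      using fan[of 0] fan[of 4] by auto
    then have "f (9 * m + i) \<in> closed_nbh ?G (f (9 * m))" "f (9 * m + j) \<in> closed_nbh ?G (f (9 * m))"
      by (auto intro!: fan_triangle_closed_nbh(2)[OF f m])
    moreover have "f (9 * m + i) \<noteq> f (9 * m + j)" using ij f by (auto simp: inj_eq)
    ultimately obtain w where "w \<in> closed_nbh ?G (f (9 * m))" "4 < c w"
      using max_once_repeated[OF fin once, of "9 * m" "f (9 * m + i)" "f (9 * m + j)"] ij m
      by (auto simp: h_def x_def)
    moreover have "closed_nbh ?G (f (9 * m)) \<subseteq> verts ?G"
      using open_nbh_subset[OF sg] m by (fastforce simp: closed_nbh_def chord_graph_def)
    ultimately show False using range by (fastforce simp: chord_graph_def x_def)
  qed
  \<comment> \<open>Three pairwise adjacent corners cannot share the two colours 3 and 4.\<close>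
  have "x 0 \<noteq> x 9" "x 9 \<noteq> x 18" "x 0 \<noteq> x 18"
    unfolding x_def by (rule proper_coloringD(1)[OF p]; simp add: fan_triangle_chords_def)+
  then show False
    using corner[of 0] corner[of 1] corner[of 2] range[of 0] range[of 9] range[of 18] by simp
qed

section \<open>The four invariants\<close>

text \<open>A colouring with \<open>m\<close> colours bounds every \<open>LEAST\<close> from above;
  for \<open>H\<close> it is attained, as no smaller number is possible.\<close>

lemma is_class_max_Least:
  assumes "\<And>G. G \<in> C \<Longrightarrow> Q G m" and "H \<in> C" and "\<And>k. Q H k \<Longrightarrow> m \<le> k"
  shows "is_class_max (\<lambda>G. LEAST k. Q G k) C m"
  unfolding is_class_max_def
proof (intro conjI ballI)
  show "\<exists>G\<in>C. (LEAST k. Q G k) = m"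
    using assms by (intro bexI[of _ H] Least_equality)
  show "(LEAST k. Q G k) \<le> m" if "G \<in> C" for G
    using assms(1)[OF that] by (rule Least_le)
qed

theorem theorem1p4:
  shows "is_class_max chi_pCFo (outerplanar_graphs_no_isolated :: 'a::infinite graph set) 5
       \<and> is_class_max chi_pCFc (outerplanar_graphs :: 'a graph set) 3
       \<and> is_class_max chi_pUMo (outerplanar_graphs_no_isolated :: 'a graph set) 5
       \<and> is_class_max chi_pUMc (outerplanar_graphs :: 'a graph set) 5"
proof (intro conjI)
  obtain f :: "nat \<Rightarrow> 'a" where f: "inj f"
    using infinite_countable_subset[OF infinite_UNIV] by blast
  \<comment> \<open>The pentagon serves both open variants, since unique-maximum colourings are
    conflict-free.\<close>
  have pentagon: "chord_graph f 5 pentagon_chords \<in> outerplanar_graphs_no_isolated"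
    using outerplanar_pentagon[OF f] no_isolated_pentagon[OF f]
    by (simp add: outerplanar_graphs_no_isolated_def)
  show "is_class_max chi_pCFo (outerplanar_graphs_no_isolated :: 'a graph set) 5"
    unfolding chi_pCFo_def[abs_def]
  proof (rule is_class_max_Least[OF _ pentagon])
    show "\<exists>c. pCFo_coloring G 5 c" if "G \<in> outerplanar_graphs_no_isolated" for G :: "'a graph"
      using that outerplanar_pUMo[of G] pUMo_imp_pCFo[of G 5]
      by (auto simp: outerplanar_graphs_no_isolated_def)
  qed (use pentagon_pCFo_coloring_ge_5[OF f] in blast)
  show "is_class_max chi_pCFc (outerplanar_graphs :: 'a graph set) 3"
    unfolding chi_pCFc_def[abs_def]
  proof (rule is_class_max_Least[where H = "chord_graph f 3 triangle_chords"])
    show "\<exists>c. pCFc_coloring G 3 c" if "G \<in> outerplanar_graphs" for G :: "'a graph"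
      using that outerplanar_3_colorable[of G] pCFc_iff_proper[of G 3]
      by (auto simp: outerplanar_graphs_def outerplanar_def)
    show "chord_graph f 3 triangle_chords \<in> outerplanar_graphs"
      using outerplanar_triangle[OF f] by (simp add: outerplanar_graphs_def)
  qed (use triangle_proper_coloring_ge_3 in \<open>auto simp: pCFc_coloring_def\<close>)
  show "is_class_max chi_pUMo (outerplanar_graphs_no_isolated :: 'a graph set) 5"
    unfolding chi_pUMo_def[abs_def]
  proof (rule is_class_max_Least[OF _ pentagon])
    show "\<exists>c. pUMo_coloring G 5 c" if "G \<in> outerplanar_graphs_no_isolated" for G :: "'a graph"
      using that outerplanar_pUMo[of G] by (auto simp: outerplanar_graphs_no_isolated_def)
  qed (use pentagon_pCFo_coloring_ge_5[OF f] pUMo_imp_pCFo in blast)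
  show "is_class_max chi_pUMc (outerplanar_graphs :: 'a graph set) 5"
    unfolding chi_pUMc_def[abs_def]
  proof (rule is_class_max_Least[where H = "chord_graph f 27 fan_triangle_chords"])
    show "\<exists>c. pUMc_coloring G 5 c" if "G \<in> outerplanar_graphs" for G :: "'a graph"
      using that outerplanar_pUMc[of G] by (auto simp: outerplanar_graphs_def)
    show "chord_graph f 27 fan_triangle_chords \<in> outerplanar_graphs"
      using outerplanar_fan_triangle[OF f] by (simp add: outerplanar_graphs_def)
  qed (use fan_triangle_pUMc_coloring_ge_5[OF f] in blast)
qed

end
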